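(* Let $\mu$ be a measure on $\mathcal{B}(\varGamma)$, let $T\in\mathcal{B}(\varGamma)$ be a transversal with respect to $\varLambda$, let $\nu_\lambda$ ($\lambda\in\varLambda$), $\nu=\sum_{\lambda\in\varLambda}\nu_\lambda$ and $h_\lambda=\frac{d\nu_\lambda}{d\nu}$ be the associated measures and densities, and let $\alpha\in(0,\infty)$. Then $\mu$ is $H$-regular (with respect to $\alpha$) if and only if, for every $\lambda\in\varLambda$, $$h_\lambda<1\quad \nu\text{-a.e.}$$
   Context: $G$ is an LCA group (locally compact abelian, Hausdorff, written additively), $H$ a closed subgroup of $G$, and $\tilde x=x+H\in\tilde G:=G/H$ for $x\in G$. $\varGamma$ is the dual group of $G$, $\langle\gamma,x\rangle$ is the value of $\gamma\in\varGamma$ at $x\in G$, and $\varLambda:=\{\gamma\in\varGamma:\langle\gamma,y\rangle=1\ \forall y\in H\}$ is the annihilator of $H$. Standing assumption: $\varLambda$ is finite or countably infinite. $\mathcal{B}(\varGamma)$ is the Borel $\sigma$-algebra of $\varGamma$. A "measure on $\mathcal{B}(\varGamma)$" means a finite non-negative regular measure: for all $B\in\mathcal{B}(\varGamma)$ and $\epsilon>0$ there are a compact $K$ and an open $U$ with $K\subset B\subset U$ and $\mu(U\setminus K)<\epsilon$. For $\alpha\in(0,\infty)$, $L^\alpha(\mu)$ is the metric space of ($\mu$-equivalence classes of) $\alpha$-integrable Borel functions $\varGamma\to\mathbb{C}$ (with metric given by the norm $\|f-g\|_{L^\alpha(\mu)}$ if $\alpha\ge1$ and by $\int|f-g|^\alpha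 d\mu$ if $\alpha<1$), and $C_\alpha\mathcal{L}$ is the closure of $\mathcal{L}\subset L^\alpha(\mu)$ in it. For non-empty $S\subseteq G$, $\mathbf{P}(S)$ is the linear space of functions $p:\varGamma\to\mathbb{C}$ that are finite sums $p(\cdot)=\sum_k a_k\langle\cdot,s_k\rangle$ with $a_k\in\mathbb{C}$, $s_k\in S$; for $x\in G$ set $\mathbf{P}(\tilde x):=\mathbf{P}(x+H)$, which depends only on $\tilde x$. A measure $\mu$ is $H$-regular (with respect to $\alpha$) if $\bigcap_{\tilde x\in\tilde G}C_\alpha\mathbf{P}(\tilde x)=\{0\}$ in $L^\alpha(\mu)$. A transversal (with respect to $\varLambda$) is a subset $T\subseteq\varGamma$ meeting each $\varLambda$-coset exactly once. Given $\mu$ and a transversal $T\in\mathcal{B}(\varGamma)$, define for $\lambda\in\varLambda$ and $B\in\mathcal{B}(\varGamma)$: $\mu_\lambda(B):=\mu(B\cap(T+\lambda))$, $\nu_\lambda(B):=\mu_\lambda(\lambda+B)$, and $\nu:=\sum_{\lambda\in\varLambda}\nu_\lambda$ (so all $\nu_\lambda$ and $\nu$ are finite measures concentrated on $T$). $h_\lambda$ denotes the Radon-Nikodym derivative of $\nu_\lambda$ with respect to $\nu$, chosen to be a Borel function with values in $[0,\infty)$ and $h_\lambda=0$ on $\varGamma\setminus T$. *)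

theory Defs
  imports "HOL-Analysis.Analysis"
begin

section \<open>The dual group\<close>

text \<open>
  A locally compact abelian group is modelled as a type \<open>'a\<close> of sort
  \<^class>\<open>topological_ab_group_add\<close> and \<^class>\<open>t2_space\<close> satisfying
  \<open>locally_compact_space (euclidean :: 'a topology)\<close>. Its dual is a type again, written
  additively, so that \<^const>\<open>borel\<close>, \<^const>\<open>compact\<close> and the group operations
  refer to the compact-open topology and to pointwise multiplication of characters.
\<close>

typedef (overloaded) ('a :: topological_ab_group_add) dual_group =
  "{\<gamma> :: 'a \<Rightarrow> complex. continuous_on UNIV \<gamma> \<and> (\<forall>x. norm (\<gamma> x) = 1) \<and>
      (\<forall>x y. \<gamma> (x + y) = \<gamma> x * \<gamma> y)}"
  morphisms pairing Abs_dual_group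
  by (rule exI[of _ "\<lambda>_. 1"]) auto

setup_lifting type_definition_dual_group

lemma continuous_on_pairing: "continuous_on A (pairing \<gamma>)"
  using pairing[of \<gamma>] continuous_on_subset by blast

lemma norm_pairing [simp]: "norm (pairing \<gamma> x) = 1"
  using pairing[of \<gamma>] by blast

lemma pairing_add_right: "pairing \<gamma> (x + y) = pairing \<gamma> x * pairing \<gamma> y"
  using pairing[of \<gamma>] by blast

instantiation dual_group :: (topological_ab_group_add) ab_group_add
begin

lift_definition zero_dual_group :: "'a dual_group" is "\<lambda>_. 1"
  by auto

lift_definition plus_dual_group :: "'a dual_group \<Rightarrow> 'a dual_group \<Rightarrow> 'a dual_group"
  is "\<lambda>\<gamma> \<delta> x. \<gamma> x * \<delta> x"
  by (auto intro: continuous_on_mult simp: norm_mult)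

lift_definition uminus_dual_group :: "'a dual_group \<Rightarrow> 'a dual_group"
  is "\<lambda>\<gamma> x. cnj (\<gamma> x)"
  by (auto intro: continuous_on_cnj)

definition minus_dual_group :: "'a dual_group \<Rightarrow> 'a dual_group \<Rightarrow> 'a dual_group"
  where "minus_dual_group \<gamma> \<delta> = \<gamma> + (- \<delta>)"

instance
proof
  fix a b c :: "'a dual_group"
  show "a + b + c = a + (b + c)" by transfer (simp add: mult.assoc)
  show "a + b = b + a" by transfer (simp add: mult.commute)
  show "0 + a = a" by transfer simp
  show "- a + a = 0"
    by transfer (auto simp: fun_eq_iff mult.commute[of "cnj _"] complex_norm_square[symmetric])
  show "a - b = a + - b" by (simp add: minus_dual_group_def)
qed

end

lemma pairing_0: "pairing 0 x = 1"
  by transfer simp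

lemma pairing_plus: "pairing (\<gamma> + \<delta>) x = pairing \<gamma> x * pairing \<delta> x"
  by transfer simp

lemma pairing_uminus: "pairing (- \<gamma>) x = cnj (pairing \<gamma> x)"
  by transfer simp

instantiation dual_group :: (topological_ab_group_add) topological_space
begin

definition open_dual_group :: "'a dual_group set \<Rightarrow> bool" where
  "open_dual_group = generate_topology
     {{\<gamma>. pairing \<gamma> ` K \<subseteq> U} | K U. compact K \<and> open U}"

instance
  by standard (simp_all add: open_dual_group_def generate_topology.intros(1,2) generate_topology.intros(3))

end

lemma open_dual_group_subbasic:
  assumes "compact K" "open U"
  shows "open {\<gamma>. pairing \<gamma> ` K \<subseteq> U}"
  unfolding open_dual_group_def using assms by (intro generate_topology.Basis) auto

lemma eventually_uniform_on_compact:
  fixes \<gamma> :: "'a :: topological_ab_group_add dual_group"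
  assumes "compact K" "e > 0"
  shows "eventually (\<lambda>\<delta>. \<forall>x\<in>K. dist (pairing \<delta> x) (pairing \<gamma> x) < e) (nhds \<gamma>)"
proof -
  define O' where "O' x = {y. dist (pairing \<gamma> y) (pairing \<gamma> x) < e/3}" for x
  define C where "C x = {y. dist (pairing \<gamma> y) (pairing \<gamma> x) \<le> e/3} \<inter> K" for x
  have op: "open (O' x)" for x
    unfolding O'_def
    by (intro open_Collect_less continuous_on_dist continuous_on_pairing continuous_on_const)
  have cl: "compact (C x)" for x
    unfolding C_def using assms(1)
    by (intro closed_Int_compact closed_Collect_le continuous_on_dist continuous_on_pairing
        continuous_on_const)
  have "K \<subseteq> \<Union>(O' ` K)" using assms(2) by (auto simp: O'_def)
  then obtain F where F: "F \<subseteq> K" "finite F" "K \<subseteq> \<Union>(O' ` F)"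
    using compactE_image[OF assms(1), of K O'] op by blast
  have "eventually (\<lambda>\<delta>. \<forall>x\<in>F. pairing \<delta> ` C x \<subseteq> ball (pairing \<gamma> x) (2*e/3)) (nhds \<gamma>)"
  proof (intro eventually_ball_finite F(2) ballI)
    fix x assume "x \<in> F"
    have "open {\<delta>. pairing \<delta> ` C x \<subseteq> ball (pairing \<gamma> x) (2*e/3)}"
      by (intro open_dual_group_subbasic cl open_ball)
    moreover have "\<gamma> \<in> {\<delta>. pairing \<delta> ` C x \<subseteq> ball (pairing \<gamma> x) (2*e/3)}"
      using assms(2) by (auto simp: C_def dist_commute)
    ultimately show "eventually (\<lambda>\<delta>. pairing \<delta> ` C x \<subseteq> ball (pairing \<gamma> x) (2*e/3)) (nhds \<gamma>)"
      by (auto simp: eventually_nhds)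
  qed
  then show ?thesis
  proof eventually_elim
    case (elim \<delta>)
    show ?case
    proof
      fix y assume y: "y \<in> K"
      then obtain x where x: "x \<in> F" "dist (pairing \<gamma> y) (pairing \<gamma> x) < e/3"
        using F(3) by (auto simp: O'_def)
      then have "y \<in> C x" using y by (auto simp: C_def)
      then have "dist (pairing \<gamma> x) (pairing \<delta> y) < 2*e/3" using elim x(1)
        by (meson image_subset_iff mem_ball)
      with x(2) show "dist (pairing \<delta> y) (pairing \<gamma> y) < e"
        using dist_triangle[of "pairing \<delta> y" "pairing \<gamma> y" "pairing \<gamma> x"]
        by (simp add: dist_commute)
    qed
  qed
qed

lemma tendsto_dual_group_iff:
  fixes \<gamma> :: "'a :: topological_ab_group_add dual_group"
  shows "(f \<longlongrightarrow> \<gamma>) F \<longleftrightarrow>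
    (\<forall>K e. compact K \<longrightarrow> e > 0 \<longrightarrow>
      eventually (\<lambda>i. \<forall>x\<in>K. dist (pairing (f i) x) (pairing \<gamma> x) < e) F)"
proof (intro iffI allI impI)
  fix K :: "'a set" and e :: real
  assume "(f \<longlongrightarrow> \<gamma>) F" "compact K" "e > 0"
  then show "eventually (\<lambda>i. \<forall>x\<in>K. dist (pairing (f i) x) (pairing \<gamma> x) < e) F"
    using eventually_uniform_on_compact[of K e \<gamma>] by (auto simp: filterlim_iff)
next
  assume *: "\<forall>K e. compact K \<longrightarrow> e > 0 \<longrightarrow>
      eventually (\<lambda>i. \<forall>x\<in>K. dist (pairing (f i) x) (pairing \<gamma> x) < e) F"
  have "\<gamma> \<in> S \<longrightarrow> eventually (\<lambda>i. f i \<in> S) F" if "open S" for S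
    using that unfolding open_dual_group_def
  proof (induction rule: generate_topology.induct)
    case UNIV
    then show ?case by simp
  next
    case (Int a b)
    then show ?case by (auto intro: eventually_conj)
  next
    case (UN K)
    show ?case
    proof
      assume "\<gamma> \<in> \<Union>K"
      then obtain X where X: "X \<in> K" "\<gamma> \<in> X" by blast
      with UN.IH have "eventually (\<lambda>i. f i \<in> X) F" by blast
      then show "eventually (\<lambda>i. f i \<in> \<Union>K) F"
        by (rule eventually_mono) (use X in blast)
    qed
  next
    case (Basis s)
    then obtain K U where KU: "s = {\<gamma>. pairing \<gamma> ` K \<subseteq> U}" "compact K" "open U" by auto
    show ?case
    proof
      assume "\<gamma> \<in> s"
      then have sub: "pairing \<gamma> ` K \<subseteq> U" using KU by auto
      have comp: "compact (pairing \<gamma> ` K)"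
        by (intro compact_continuous_image continuous_on_pairing KU)
      obtain e where e: "e > 0" "(\<Union>x\<in>pairing \<gamma> ` K. ball x e) \<subseteq> U"
        by (rule compact_subset_open_imp_ball_epsilon_subset[OF comp KU(3) sub])
      have "eventually (\<lambda>i. \<forall>x\<in>K. dist (pairing (f i) x) (pairing \<gamma> x) < e) F"
        using * KU e by blast
      then show "eventually (\<lambda>i. f i \<in> s) F"
      proof eventually_elim
        case (elim i)
        show ?case unfolding KU(1)
        proof safe
          fix x assume "x \<in> K"
          with elim have "pairing (f i) x \<in> ball (pairing \<gamma> x) e" by (simp add: dist_commute)
          with \<open>x \<in> K\<close> e(2) show "pairing (f i) x \<in> U" by blast
        qed
      qed
    qed
  qed
  then show "(f \<longlongrightarrow> \<gamma>) F" by (auto simp: tendsto_def)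
qed

instance dual_group :: (topological_ab_group_add) topological_ab_group_add
proof
  fix a b :: "'a dual_group"
  show "((\<lambda>x. fst x + snd x) \<longlongrightarrow> a + b) (nhds a \<times>\<^sub>F nhds b)"
    unfolding tendsto_dual_group_iff
  proof (intro allI impI)
    fix K :: "'a set" and e :: real
    assume K: "compact K" "e > 0"
    have "eventually (\<lambda>p. (\<forall>x\<in>K. dist (pairing (fst p) x) (pairing a x) < e/2) \<and>
        (\<forall>x\<in>K. dist (pairing (snd p) x) (pairing b x) < e/2)) (nhds a \<times>\<^sub>F nhds b)"
      using K(2)
      by (intro eventually_conj
          eventually_compose_filterlim[OF eventually_uniform_on_compact[OF K(1)] filterlim_fst]
          eventually_compose_filterlim[OF eventually_uniform_on_compact[OF K(1)] filterlim_snd])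
        auto
    then show "eventually (\<lambda>p. \<forall>x\<in>K. dist (pairing (fst p + snd p) x) (pairing (a + b) x) < e)
        (nhds a \<times>\<^sub>F nhds b)"
    proof eventually_elim
      case (elim p)
      show ?case
      proof
        fix x assume x: "x \<in> K"
        let ?c = "pairing (fst p) x" and ?d = "pairing (snd p) x"
        have "?c * ?d - pairing a x * pairing b x =
            (?c - pairing a x) * ?d + pairing a x * (?d - pairing b x)"
          by (simp add: algebra_simps)
        then have "norm (?c * ?d - pairing a x * pairing b x) \<le>
            norm (?c - pairing a x) + norm (?d - pairing b x)"
          using norm_triangle_ineq[of "(?c - pairing a x) * ?d" "pairing a x * (?d - pairing b x)"]
          by (simp add: norm_mult)
        moreover have "dist ?c (pairing a x) < e/2" "dist ?d (pairing b x) < e/2"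
          using elim x by auto
        ultimately show "dist (pairing (fst p + snd p) x) (pairing (a + b) x) < e"
          by (simp add: pairing_plus dist_norm)
      qed
    qed
  qed
  show "(uminus \<longlongrightarrow> - a) (nhds a)"
    unfolding tendsto_dual_group_iff pairing_uminus dist_norm complex_cnj_diff[symmetric]
      complex_mod_cnj
    using eventually_uniform_on_compact[of _ _ a] by (simp add: dist_norm)
qed

instance dual_group :: (topological_ab_group_add) t2_space
proof
  fix a b :: "'a dual_group"
  assume "a \<noteq> b"
  then obtain x where x: "pairing a x \<noteq> pairing b x"
    by (auto simp: pairing_inject[symmetric] fun_eq_iff)
  obtain U V where UV: "open U" "open V" "pairing a x \<in> U" "pairing b x \<in> V" "U \<inter> V = {}"
    using hausdorff[OF x] by blast
  have "open {\<gamma>. pairing \<gamma> ` {x} \<subseteq> U}" "open {\<gamma>. pairing \<gamma> ` {x} \<subseteq> V}"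
    using UV by (intro open_dual_group_subbasic; simp)+
  moreover have "{\<gamma>. pairing \<gamma> ` {x} \<subseteq> U} \<inter> {\<gamma>. pairing \<gamma> ` {x} \<subseteq> V} = {}"
    using UV(5) by auto
  moreover have "a \<in> {\<gamma>. pairing \<gamma> ` {x} \<subseteq> U}" "b \<in> {\<gamma>. pairing \<gamma> ` {x} \<subseteq> V}"
    using UV(3,4) by auto
  ultimately show "\<exists>U V. open U \<and> open V \<and> a \<in> U \<and> b \<in> V \<and> U \<inter> V = {}"
    by blast
qed


section \<open>Subgroups, cosets, annihilators and transversals\<close>

definition add_subgroup :: "'a :: ab_group_add set \<Rightarrow> bool" where
  "add_subgroup H \<longleftrightarrow> 0 \<in> H \<and> (\<forall>x\<in>H. \<forall>y\<in>H. x + y \<in> H) \<and> (\<forall>x\<in>H. - x \<in> H)"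

definition cosets :: "'a :: ab_group_add set \<Rightarrow> 'a set set" where
  "cosets H = range (\<lambda>x. (\<lambda>y. x + y) ` H)"

definition annihilator :: "'a :: topological_ab_group_add set \<Rightarrow> 'a dual_group set" where
  "annihilator H = {\<gamma>. \<forall>y\<in>H. pairing \<gamma> y = 1}"

definition transversal :: "'a :: ab_group_add set \<Rightarrow> 'a set \<Rightarrow> bool" where
  "transversal L T \<longleftrightarrow> (\<forall>C\<in>cosets L. \<exists>!t. t \<in> T \<inter> C)"


section \<open>Regular measures and the spaces of integrable functions\<close>

definition regular_borel_measure :: "'b :: topological_space measure \<Rightarrow> bool" where
  "regular_borel_measure \<mu> \<longleftrightarrow> sets \<mu> = sets borel \<and> finite_measure \<mu> \<and>
     (\<forall>B\<in>sets borel. \<forall>\<epsilon>>0. \<exists>K U. compact K \<and> open U \<and> K \<subseteq> B \<and> B \<subseteq> U \<and>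
        measure \<mu> (U - K) < \<epsilon>)"

text \<open>
  Elements of \<open>L\<^sup>\<alpha>(\<mu>)\<close> are represented by functions; \<open>Lalpha_dist\<close> is the resulting
  pseudometric, so the closure below is a set of functions closed under equality
  almost everywhere, and \<open>{0}\<close> becomes the set of functions vanishing almost everywhere.
\<close>

definition Lalpha :: "real \<Rightarrow> 'b measure \<Rightarrow> ('b \<Rightarrow> complex) set" where
  "Lalpha \<alpha> \<mu> = {f. f \<in> borel_measurable \<mu> \<and> integrable \<mu> (\<lambda>\<gamma>. norm (f \<gamma>) powr \<alpha>)}"

definition Lalpha_dist :: "real \<Rightarrow> 'b measure \<Rightarrow> ('b \<Rightarrow> complex) \<Rightarrow> ('b \<Rightarrow> complex) \<Rightarrow> real" where
  "Lalpha_dist \<alpha> \<mu> f g =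
     (if \<alpha> \<ge> 1 then (\<integral>\<gamma>. norm (f \<gamma> - g \<gamma>) powr \<alpha> \<partial>\<mu>) powr (1 / \<alpha>)
      else (\<integral>\<gamma>. norm (f \<gamma> - g \<gamma>) powr \<alpha> \<partial>\<mu>))"

definition Lalpha_closure :: "real \<Rightarrow> 'b measure \<Rightarrow> ('b \<Rightarrow> complex) set \<Rightarrow> ('b \<Rightarrow> complex) set" where
  "Lalpha_closure \<alpha> \<mu> A = {f \<in> Lalpha \<alpha> \<mu>. \<forall>\<epsilon>>0. \<exists>g\<in>A. Lalpha_dist \<alpha> \<mu> f g < \<epsilon>}"

definition trig_polys ::
  "'a :: topological_ab_group_add set \<Rightarrow> ('a dual_group \<Rightarrow> complex) set" where
  "trig_polys S = {p. \<exists>(n :: nat) (a :: nat \<Rightarrow> complex) s. (\<forall>k<n. s k \<in> S) \<and>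
     p = (\<lambda>\<gamma>. \<Sum>k<n. a k * pairing \<gamma> (s k))}"

lemma trig_polys_subset_Lalpha:
  assumes "regular_borel_measure \<mu>" "\<alpha> > 0"
  shows "trig_polys S \<subseteq> Lalpha \<alpha> \<mu>"
proof
  fix p :: "'a dual_group \<Rightarrow> complex"
  assume "p \<in> trig_polys S"
  then obtain n :: nat and a s where p: "p = (\<lambda>\<gamma>. \<Sum>k<n. a k * pairing \<gamma> (s k))"
    by (auto simp: trig_polys_def)
  interpret finite_measure \<mu> using assms by (simp add: regular_borel_measure_def)
  have sets: "sets \<mu> = sets borel" using assms by (simp add: regular_borel_measure_def)
  have "continuous_on UNIV (\<lambda>\<gamma>. pairing \<gamma> x)" for x :: 'a
  proof (subst continuous_on_open_vimage, simp, intro allI impI)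
    fix U :: "complex set" assume "open U"
    then have "open {\<gamma> :: 'a dual_group. pairing \<gamma> ` {x} \<subseteq> U}"
      by (intro open_dual_group_subbasic) auto
    then show "open ((\<lambda>\<gamma>. pairing \<gamma> x) -` U \<inter> UNIV)" by (simp add: vimage_def)
  qed
  then have "continuous_on UNIV p" unfolding p by (intro continuous_intros) auto
  then have m: "p \<in> borel_measurable \<mu>"
    using borel_measurable_continuous_onI measurable_cong_sets[OF sets refl] by blast
  have "norm (p \<gamma>) \<le> (\<Sum>k<n. norm (a k))" for \<gamma>
    unfolding p by (rule order.trans[OF norm_sum]) (simp add: norm_mult)
  then have "integrable \<mu> (\<lambda>\<gamma>. norm (p \<gamma>) powr \<alpha>)"
    using m assms(2) by (intro integrable_const_bound[of _ "(\<Sum>k<n. norm (a k)) powr \<alpha>"])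
      (auto intro!: powr_mono2)
  with m show "p \<in> Lalpha \<alpha> \<mu>" by (simp add: Lalpha_def)
qed

definition H_regular ::
  "real \<Rightarrow> 'a :: topological_ab_group_add set \<Rightarrow> 'a dual_group measure \<Rightarrow> bool" where
  "H_regular \<alpha> H \<mu> \<longleftrightarrow>
     (\<Inter>S\<in>cosets H. Lalpha_closure \<alpha> \<mu> (trig_polys S)) =
     {f \<in> Lalpha \<alpha> \<mu>. AE \<gamma> in \<mu>. f \<gamma> = 0}"


section \<open>The measures associated with a transversal\<close>

definition mu_part :: "'b :: {topological_space, ab_group_add} measure \<Rightarrow> 'b set \<Rightarrow> 'b \<Rightarrow> 'b measure"
  where "mu_part \<mu> T l = density \<mu> (indicator ((\<lambda>t. t + l) ` T))"

definition nu_part :: "'b :: {topological_space, ab_group_add} measure \<Rightarrow> 'b set \<Rightarrow> 'b \<Rightarrow> 'b measure"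
  where "nu_part \<mu> T l = distr (mu_part \<mu> T l) borel (\<lambda>\<gamma>. \<gamma> - l)"

definition nu_sum ::
  "'b :: {topological_space, ab_group_add} measure \<Rightarrow> 'b set \<Rightarrow> 'b set \<Rightarrow> 'b measure" where
  "nu_sum \<mu> T L =
     measure_of UNIV (sets borel) (\<lambda>B. \<integral>\<^sup>+ l. emeasure (nu_part \<mu> T l) B \<partial>count_space L)"

lemma translate_vimage: "(\<lambda>t. t + l) ` B = (\<lambda>x. x - l) -` (B :: 'b :: ab_group_add set)"
  by (auto simp: image_iff) (metis diff_add_cancel)

lemma borel_measurable_translate:
  "(\<lambda>x :: 'b :: topological_ab_group_add. x - l) \<in> borel_measurable borel"
  by (intro borel_measurable_continuous_onI continuous_on_diff continuous_on_id continuous_on_const)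

lemma borel_translate:
  fixes B :: "'b :: topological_ab_group_add set"
  assumes "B \<in> sets borel"
  shows "(\<lambda>t. t + l) ` B \<in> sets borel"
  using measurable_sets[OF borel_measurable_translate assms] by (simp add: translate_vimage)

lemma emeasure_mu_part:
  fixes \<mu> :: "'b :: topological_ab_group_add measure"
  assumes "sets \<mu> = sets borel" "T \<in> sets borel" "B \<in> sets borel"
  shows "emeasure (mu_part \<mu> T l) B = emeasure \<mu> (B \<inter> (\<lambda>t. t + l) ` T)"
  unfolding mu_part_def using assms borel_translate[OF assms(2), of l]
  by (subst emeasure_density)
    (auto simp: indicator_inter_arith[symmetric] mult.commute Int_commute nn_integral_indicator)

lemma emeasure_nu_part:
  fixes \<mu> :: "'b :: topological_ab_group_add measure"
  assumes "sets \<mu> = sets borel" "B \<in> sets borel"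
  shows "emeasure (nu_part \<mu> T l) B = emeasure (mu_part \<mu> T l) ((\<lambda>b. l + b) ` B)"
proof -
  have s: "sets (mu_part \<mu> T l) = sets borel" using assms by (simp add: mu_part_def)
  then have sp: "space (mu_part \<mu> T l) = UNIV" using sets_eq_imp_space_eq by fastforce
  have "(\<lambda>\<gamma>. \<gamma> - l) \<in> measurable (mu_part \<mu> T l) borel"
    using borel_measurable_translate measurable_cong_sets[OF s refl] by blast
  then show ?thesis unfolding nu_part_def
    using assms by (simp add: emeasure_distr sp translate_vimage[symmetric] add.commute)
qed

lemma sets_nu_sum [simp]: "sets (nu_sum \<mu> T L) = sets borel"
  by (simp add: nu_sum_def sets_measure_of_conv sets.sigma_sets_eq[of borel, simplified])

lemma emeasure_nu_sum:
  assumes "B \<in> sets borel"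
  shows "emeasure (nu_sum \<mu> T L) B = (\<integral>\<^sup>+ l. emeasure (nu_part \<mu> T l) B \<partial>count_space L)"
proof (rule emeasure_measure_of[OF nu_sum_def])
  show "countably_additive (sets (nu_sum \<mu> T L))
     (\<lambda>B. \<integral>\<^sup>+ l. emeasure (nu_part \<mu> T l) B \<partial>count_space L)"
  proof (rule countably_additiveI)
    fix A :: "nat \<Rightarrow> 'a set"
    assume A: "range A \<subseteq> sets (nu_sum \<mu> T L)" "disjoint_family A"
    then have "range A \<subseteq> sets (nu_part \<mu> T l)" for l by (simp add: nu_part_def)
    then show "(\<Sum>i. \<integral>\<^sup>+ l. emeasure (nu_part \<mu> T l) (A i) \<partial>count_space L) =
        (\<integral>\<^sup>+ l. emeasure (nu_part \<mu> T l) (\<Union> (range A)) \<partial>count_space L)"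
      using A(2) by (subst nn_integral_suminf[symmetric]) (auto simp: suminf_emeasure)
  qed
qed (use assms in \<open>auto simp: positive_def\<close>)

end

theory Submission
  imports Defs
begin

text \<open>
  Write \<open>\<Lambda>\<close> for the annihilator of \<open>H\<close>. Everything rests on the behaviour of
  \<open>P(x + H)\<close> under translation by \<open>\<Lambda>\<close>: a polynomial \<open>p\<close> with frequencies in \<open>x + H\<close>
  satisfies \<open>p(\<gamma> + \<lambda>) = \<langle>\<lambda>, x\<rangle> p(\<gamma>)\<close>. Both the density condition and \<open>H\<close>-regularity are
  compared with a third condition: no set \<open>A + \<lambda>\<close> with \<open>A \<subseteq> T\<close> has positive measure while all
  the other translates \<open>A + \<lambda>'\<close> are null. Since the densities \<open>h\<^sub>\<lambda>\<close> add up to \<open>1\<close>, such a set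
  \<open>A\<close> lives where \<open>h\<^sub>\<lambda> = 1\<close>, which links it to the densities (\<open>densities_less_1_iff\<close>).

  If there is no such set, let \<open>f\<close> lie in all the closures. Limits of polynomials inherit the
  translation rule almost everywhere. If \<open>\<gamma>\<close> and \<open>\<gamma> + \<lambda>\<close> lie off a suitable null set, the rules
  for \<open>0\<close> and for an \<open>x\<close> with \<open>\<langle>\<lambda>, x\<rangle> \<noteq> 1\<close> contradict each other unless \<open>f(\<gamma>) = 0\<close>
  (\<open>Lalpha_closure_Inter_vanishes\<close>). So off this null set, \<open>f\<close> can be nonzero only at points all
  of whose other translates fall into it, and by assumption these points form a null set.

  Conversely, if \<open>B = A + \<lambda>\<close> is such a set, then its indicator lies in every closure, although it
  does not vanish almost everywhere (\<open>indicator_in_Lalpha_closure\<close>). After division by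
  \<open>\<langle>\<cdot>, x\<rangle>\<close> this asks for an approximation of \<open>1\<^sub>B \<langle>\<cdot>, -x\<rangle>\<close> by elements of
  \<open>P(H)\<close>. The set \<open>B\<close> meets each coset of \<open>\<Lambda>\<close> at most once and its other translates are null, so
  after removing these translates the restrictions of characters to \<open>H\<close> distinguish the points of
  \<open>B\<close> from each other and from all remaining points. Regularity of \<open>\<mu>\<close> reduces the problem to a
  large compact set, and there the Stone--Weierstrass theorem applies. The polynomials must also
  stay bounded off that compact set, for otherwise their \<open>L\<^sup>\<alpha>\<close>-norm is not controlled;
  composing with a one-variable polynomial close to a truncation achieves this.
\<close>

section \<open>Stone--Weierstrass for algebras that need not separate points\<close>

text \<open>
  A copy of \<open>'b \<Rightarrow> real\<close> with the product topology. The function type itself has a metric for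
  countable \<open>'b\<close>, and the resulting arity of \<^class>\<open>t2_space\<close> excludes an instance for
  arbitrary \<open>'b\<close>.
\<close>
typedef 'b tuple = "UNIV :: ('b \<Rightarrow> real) set"
  morphisms coord Tuple ..

instantiation tuple :: (type) topological_space
begin

definition open_tuple :: "'a tuple set \<Rightarrow> bool" where
  "open_tuple S \<longleftrightarrow> open (Tuple -` S)"

instance
  by standard (auto simp: open_tuple_def vimage_Union)

end

lemma continuous_on_Tuple: "continuous_on UNIV Tuple"
  by (auto simp: continuous_on_open_vimage open_tuple_def)

lemma continuous_on_coord: "continuous_on UNIV (\<lambda>u. coord u i)"
proof (rule continuous_on_product_then_coordinatewise)
  show "continuous_on UNIV coord"
    by (auto simp: continuous_on_open_vimage open_tuple_def vimage_def Tuple_inverse)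
qed

instance tuple :: (type) t2_space
proof
  fix u v :: "'a tuple"
  assume "u \<noteq> v"
  then obtain i where "coord u i \<noteq> coord v i"
    by (auto simp: coord_inject[symmetric] fun_eq_iff)
  then obtain U V where UV: "open U" "open V" "coord u i \<in> U" "coord v i \<in> V" "U \<inter> V = {}"
    using hausdorff by metis
  have "open ((\<lambda>w :: 'a tuple. coord w i) -` U)" "open ((\<lambda>w :: 'a tuple. coord w i) -` V)"
    using UV(1,2) by (auto intro!: open_vimage continuous_on_coord)
  then show "\<exists>U V. open U \<and> open V \<and> u \<in> U \<and> v \<in> V \<and> U \<inter> V = {}"
    using UV(3-5) by (intro exI[of _ "(\<lambda>w. coord w i) -` U"] exI[of _ "(\<lambda>w. coord w i) -` V"]) auto
qed

text \<open>A continuous map from a compact space to a Hausdorff space is closed, hence a quotient map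
  onto its image.\<close>
lemma continuous_factor_through_image:
  fixes e :: "'b :: topological_space \<Rightarrow> 'c :: t2_space" and g :: "'b \<Rightarrow> 'd :: topological_space"
  assumes K: "compact K" and e: "continuous_on K e" and g: "continuous_on K g"
    and factor: "\<And>x y. x \<in> K \<Longrightarrow> y \<in> K \<Longrightarrow> e x = e y \<Longrightarrow> g x = g y"
  obtains G where "continuous_on (e ` K) G" "\<And>x. x \<in> K \<Longrightarrow> G (e x) = g x"
proof
  define G where "G u = g (inv_into K e u)" for u
  show Ge: "G (e x) = g x" if "x \<in> K" for x
    unfolding G_def
    by (rule factor) (use that in \<open>auto intro: inv_into_into f_inv_into_f\<close>)
  show "continuous_on (e ` K) G"
    unfolding continuous_on_closed_vimage[OF compact_imp_closed[OF compact_continuous_image[OF e K]]]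
  proof (intro allI impI)
    fix B :: "'d set" assume "closed B"
    then obtain C where C: "closed C" "C \<inter> K = g -` B \<inter> K"
      using g unfolding continuous_on_closed_invariant by blast
    have "compact (C \<inter> K)" using C(1) K by (rule closed_Int_compact)
    then have "compact (e ` (C \<inter> K))"
      by (intro compact_continuous_image continuous_on_subset[OF e]) auto
    moreover have "G -` B \<inter> e ` K = e ` (C \<inter> K)"
      unfolding C(2) using Ge by auto
    ultimately show "closed (G -` B \<inter> e ` K)" by (simp add: compact_imp_closed)
  qed
qed

text \<open>
  Evaluation maps \<open>K\<close> to the tuple of the values of all \<open>f \<in> R\<close>. On the compact image the
  coordinates separate points, so the usual Stone--Weierstrass theorem applies there and can be
  pulled back.
\<close>
lemma Stone_Weierstrass_factoring:
  fixes R :: "('b :: topological_space \<Rightarrow> real) set"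
  assumes K: "compact K"
    and cont: "\<And>f. f \<in> R \<Longrightarrow> continuous_on K f"
    and const: "\<And>c. (\<lambda>_. c) \<in> R"
    and add: "\<And>f g. f \<in> R \<Longrightarrow> g \<in> R \<Longrightarrow> (\<lambda>x. f x + g x) \<in> R"
    and mult: "\<And>f g. f \<in> R \<Longrightarrow> g \<in> R \<Longrightarrow> (\<lambda>x. f x * g x) \<in> R"
    and g: "continuous_on K g"
    and factor: "\<And>x y. x \<in> K \<Longrightarrow> y \<in> K \<Longrightarrow> (\<forall>f\<in>R. f x = f y) \<Longrightarrow> g x = g y"
    and "\<epsilon> > 0"
  obtains p where "p \<in> R" "\<And>x. x \<in> K \<Longrightarrow> \<bar>p x - g x\<bar> < \<epsilon>"
proof -
  define e where "e x = Tuple (\<lambda>f. if f \<in> R then f x else 0)" for x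
  have coord_e: "coord (e x) f = (if f \<in> R then f x else 0)" for x f
    by (simp add: e_def Tuple_inverse)
  have ce: "continuous_on K e"
    unfolding e_def
  proof (rule continuous_on_compose2[OF continuous_on_Tuple])
    show "continuous_on K (\<lambda>x f. if f \<in> R then f x else 0)"
    proof (rule continuous_on_coordinatewise_then_product)
      show "continuous_on K (\<lambda>x. if f \<in> R then f x else 0)" for f
        by (cases "f \<in> R") (auto simp: cont)
    qed
  qed simp
  have eq: "g x = g y" if "x \<in> K" "y \<in> K" "e x = e y" for x y
  proof (rule factor[OF that(1,2)], intro ballI)
    fix f assume "f \<in> R"
    then show "f x = f y" using arg_cong[OF that(3), of "\<lambda>u. coord u f"] by (simp add: coord_e)
  qed
  obtain G where G: "continuous_on (e ` K) G" "\<And>x. x \<in> K \<Longrightarrow> G (e x) = g x"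
    by (rule continuous_factor_through_image[OF K ce g eq]) auto
  define Q where "Q = {q. continuous_on UNIV q \<and> (\<lambda>x. q (e x)) \<in> R}"
  interpret function_ring_on Q "e ` K"
  proof
    show "compact (e ` K)" by (rule compact_continuous_image[OF ce K])
  next
    fix u v assume "u \<in> e ` K" "v \<in> e ` K" "u \<noteq> v"
    then obtain f where f: "coord u f \<noteq> coord v f" "f \<in> R"
      by (auto simp: coord_inject[symmetric] coord_e fun_eq_iff split: if_splits)
    then have "(\<lambda>u. coord u f) \<in> Q" by (simp add: Q_def coord_e continuous_on_coord)
    with f(1) show "\<exists>q\<in>Q. q u \<noteq> q v" by (intro bexI[of _ "\<lambda>u. coord u f"])
  qed (auto simp: Q_def const add mult intro: continuous_on_subset continuous_intros)
  obtain q where q: "q \<in> Q" "\<forall>u\<in>e ` K. \<bar>G u - q u\<bar> < \<epsilon>"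
    using Stone_Weierstrass_basic[OF G(1) \<open>\<epsilon> > 0\<close>] by auto
  show thesis
  proof
    show "(\<lambda>x. q (e x)) \<in> R" using q(1) by (simp add: Q_def)
    show "\<bar>q (e x) - g x\<bar> < \<epsilon>" if "x \<in> K" for x
      using q(2) G(2)[OF that] that abs_minus_commute by fastforce
  qed
qed

lemma real_polynomial_function_comp_in_algebra:
  fixes R :: "('b \<Rightarrow> real) set" and q :: "real \<Rightarrow> real"
  assumes "real_polynomial_function q" "p \<in> R"
    and const: "\<And>c. (\<lambda>_. c) \<in> R"
    and add: "\<And>f g. f \<in> R \<Longrightarrow> g \<in> R \<Longrightarrow> (\<lambda>x. f x + g x) \<in> R"
    and mult: "\<And>f g. f \<in> R \<Longrightarrow> g \<in> R \<Longrightarrow> (\<lambda>x. f x * g x) \<in> R"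
  shows "(\<lambda>x. q (p x)) \<in> R"
  using assms(1)
proof induction
  case (linear f)
  then have "f t = t * f 1" for t
    using linear_simps(5)[OF linear, of t 1] by simp
  then have "(\<lambda>x. f (p x)) = (\<lambda>x. p x * f 1)" by metis
  then show ?case using mult[OF \<open>p \<in> R\<close> const] by simp
qed (auto simp: const add mult)

text \<open>
  The approximation holds on \<open>K\<close> only, but the bound holds everywhere. It comes from composing an
  approximant with a one-variable polynomial that is close to the truncation to \<open>[-c, c]\<close> on the
  whole range of the approximant.
\<close>
lemma Stone_Weierstrass_factoring_bounded:
  fixes R :: "('b :: topological_space \<Rightarrow> real) set"
  assumes K: "compact K"
    and cont: "\<And>f. f \<in> R \<Longrightarrow> continuous_on K f"
    and bdd: "\<And>f. f \<in> R \<Longrightarrow> \<exists>M. \<forall>x. \<bar>f x\<bar> \<le> M"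
    and const: "\<And>c. (\<lambda>_. c) \<in> R"
    and add: "\<And>f g. f \<in> R \<Longrightarrow> g \<in> R \<Longrightarrow> (\<lambda>x. f x + g x) \<in> R"
    and mult: "\<And>f g. f \<in> R \<Longrightarrow> g \<in> R \<Longrightarrow> (\<lambda>x. f x * g x) \<in> R"
    and g: "continuous_on K g"
    and factor: "\<And>x y. x \<in> K \<Longrightarrow> y \<in> K \<Longrightarrow> (\<forall>f\<in>R. f x = f y) \<Longrightarrow> g x = g y"
    and gb: "\<And>x. x \<in> K \<Longrightarrow> \<bar>g x\<bar> \<le> c"
    and "c \<ge> 0" "\<epsilon> > 0"
  obtains p where "p \<in> R" "\<And>x. x \<in> K \<Longrightarrow> \<bar>p x - g x\<bar> < \<epsilon>" "\<And>x. \<bar>p x\<bar> < c + \<epsilon>"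
proof -
  have "\<epsilon>/2 > 0" using \<open>\<epsilon> > 0\<close> by simp
  from Stone_Weierstrass_factoring[OF K cont const add mult g factor this]
  obtain p where p: "p \<in> R" "\<And>x. x \<in> K \<Longrightarrow> \<bar>p x - g x\<bar> < \<epsilon>/2" by blast
  obtain M where M: "\<And>x. \<bar>p x\<bar> \<le> M" using bdd[OF p(1)] by auto
  define clip where "clip t = max (-c) (min c t)" for t :: real
  have "continuous_on {-M..M} clip" unfolding clip_def by (intro continuous_intros)
  then obtain q where q: "real_polynomial_function q" "\<And>t. t \<in> {-M..M} \<Longrightarrow> \<bar>clip t - q t\<bar> < \<epsilon>/2"
    using Stone_Weierstrass_real_polynomial_function[of "{-M..M}" clip "\<epsilon>/2"] \<open>\<epsilon>/2 > 0\<close>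
    by auto
  have q': "\<bar>clip (p x) - q (p x)\<bar> < \<epsilon>/2" for x
    using q(2)[of "p x"] M[of x] by (simp add: abs_le_iff)
  show thesis
  proof
    show "(\<lambda>x. q (p x)) \<in> R"
      by (rule real_polynomial_function_comp_in_algebra[OF q(1) p(1) const add mult])
    show "\<bar>q (p x) - g x\<bar> < \<epsilon>" if "x \<in> K" for x
      using q'[of x] p(2)[OF that] gb[OF that] unfolding clip_def by (simp add: abs_if max_def min_def split: if_splits)
    show "\<bar>q (p x)\<bar> < c + \<epsilon>" for x
      using q'[of x] \<open>c \<ge> 0\<close> \<open>\<epsilon> > 0\<close> unfolding clip_def by (simp add: abs_if max_def min_def split: if_splits)
  qed
qed

section \<open>Approximation by trigonometric polynomials\<close>

lemma pairing_0_right: "pairing \<gamma> 0 = 1"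
proof -
  have "pairing \<gamma> 0 * pairing \<gamma> 0 = pairing \<gamma> 0" using pairing_add_right[of \<gamma> 0 0] by simp
  moreover have "pairing \<gamma> 0 \<noteq> 0" using norm_pairing[of \<gamma> 0] by force
  ultimately show ?thesis by simp
qed

lemma pairing_mult_cnj: "pairing \<gamma> x * cnj (pairing \<gamma> x) = 1"
  by (simp add: complex_norm_square[symmetric])

lemma pairing_uminus_right: "pairing \<gamma> (- x) = cnj (pairing \<gamma> x)"
proof -
  have "pairing \<gamma> x * pairing \<gamma> (- x) = pairing \<gamma> x * cnj (pairing \<gamma> x)"
    by (simp add: pairing_add_right[symmetric] pairing_0_right pairing_mult_cnj)
  moreover have "pairing \<gamma> x \<noteq> 0" using norm_pairing[of \<gamma> x] by force
  ultimately show ?thesis by simp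
qed

lemma pairing_diff: "pairing (\<gamma> - \<delta>) x = pairing \<gamma> x * cnj (pairing \<delta> x)"
  by (simp only: minus_dual_group_def pairing_plus pairing_uminus)

lemma add_subgroup_annihilator: "add_subgroup (annihilator H)"
  by (auto simp: add_subgroup_def annihilator_def pairing_0 pairing_plus pairing_uminus)

lemma continuous_on_pairing_left: "continuous_on A (\<lambda>\<gamma>. pairing \<gamma> x)"
proof -
  have "open ((\<lambda>\<gamma>. pairing \<gamma> x) -` U)" if "open U" for U
    using open_dual_group_subbasic[of "{x}" U] that by (simp add: vimage_def)
  then have "continuous_on UNIV (\<lambda>\<gamma>. pairing \<gamma> x)" by (simp add: continuous_on_open_vimage)
  then show ?thesis by (rule continuous_on_subset) simp
qed

lemma trig_polys_zero: "(\<lambda>_. 0) \<in> trig_polys S"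
  unfolding trig_polys_def by (auto intro!: exI[of _ "0::nat"])

lemma trig_polys_add_monomial:
  assumes "p \<in> trig_polys S" "s \<in> S"
  shows "(\<lambda>\<gamma>. p \<gamma> + a * pairing \<gamma> s) \<in> trig_polys S"
proof -
  obtain n :: nat and b t where p: "\<And>k. k < n \<Longrightarrow> t k \<in> S" "p = (\<lambda>\<gamma>. \<Sum>k<n. b k * pairing \<gamma> (t k))"
    using assms(1) by (auto simp: trig_polys_def)
  have "\<forall>k<Suc n. (t(n := s)) k \<in> S" using p(1) assms(2) by (auto simp: less_Suc_eq)
  moreover have "(\<lambda>\<gamma>. p \<gamma> + a * pairing \<gamma> s) =
      (\<lambda>\<gamma>. \<Sum>k<Suc n. (b(n := a)) k * pairing \<gamma> ((t(n := s)) k))"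
    by (auto simp: p(2) fun_eq_iff intro!: sum.cong)
  ultimately show ?thesis unfolding trig_polys_def by blast
qed

lemma trig_polys_induct [consumes 1, case_names zero add_monomial]:
  assumes "p \<in> trig_polys S" and "P (\<lambda>_. 0)"
    and "\<And>q a s. q \<in> trig_polys S \<Longrightarrow> P q \<Longrightarrow> s \<in> S \<Longrightarrow> P (\<lambda>\<gamma>. q \<gamma> + a * pairing \<gamma> s)"
  shows "P p"
proof -
  obtain n :: nat and b t where p: "\<And>k. k < n \<Longrightarrow> t k \<in> S" "p = (\<lambda>\<gamma>. \<Sum>k<n. b k * pairing \<gamma> (t k))"
    using assms(1) by (auto simp: trig_polys_def)
  have "P (\<lambda>\<gamma>. \<Sum>k<m. b k * pairing \<gamma> (t k)) \<and>
      (\<lambda>\<gamma>. \<Sum>k<m. b k * pairing \<gamma> (t k)) \<in> trig_polys S" if "m \<le> n" for m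
    using that
  proof (induction m)
    case (Suc m)
    let ?q = "\<lambda>\<gamma>. \<Sum>k<m. b k * pairing \<gamma> (t k)"
    have q: "P ?q" "?q \<in> trig_polys S" and t: "t m \<in> S" using Suc p(1) by simp_all
    show ?case
      unfolding sum.lessThan_Suc using assms(3)[OF q(2,1) t] trig_polys_add_monomial[OF q(2) t] by blast
  qed (simp add: assms(2) trig_polys_zero)
  then show ?thesis using p(2) by blast
qed

lemma trig_polys_add:
  assumes "p \<in> trig_polys S" "q \<in> trig_polys S"
  shows "(\<lambda>\<gamma>. p \<gamma> + q \<gamma>) \<in> trig_polys S"
  using assms(2)
proof (induction rule: trig_polys_induct)
  case (add_monomial q a s)
  then show ?case using trig_polys_add_monomial[of "\<lambda>\<gamma>. p \<gamma> + q \<gamma>" S s a] by (simp add: add.assoc)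
qed (simp add: assms(1))

lemma trig_polys_monomial_mult:
  assumes "p \<in> trig_polys S" and "\<And>s. s \<in> S \<Longrightarrow> x + s \<in> S'"
  shows "(\<lambda>\<gamma>. a * pairing \<gamma> x * p \<gamma>) \<in> trig_polys S'"
  using assms(1)
proof (induction rule: trig_polys_induct)
  case (add_monomial q b s)
  have "(\<lambda>\<gamma>. a * pairing \<gamma> x * (q \<gamma> + b * pairing \<gamma> s)) =
      (\<lambda>\<gamma>. a * pairing \<gamma> x * q \<gamma> + (a * b) * pairing \<gamma> (x + s))"
    by (simp add: pairing_add_right algebra_simps)
  then show ?case
    using trig_polys_add_monomial[OF add_monomial.IH assms(2)[OF \<open>s \<in> S\<close>], of "a * b"] by simp
qed (simp add: trig_polys_zero)

lemma trig_polys_const: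
  assumes "0 \<in> S"
  shows "(\<lambda>_. c) \<in> trig_polys S"
  using trig_polys_add_monomial[OF trig_polys_zero assms, of c] by (simp add: pairing_0_right)

lemma trig_polys_mult:
  assumes H: "add_subgroup H" and p: "p \<in> trig_polys H" and q: "q \<in> trig_polys H"
  shows "(\<lambda>\<gamma>. p \<gamma> * q \<gamma>) \<in> trig_polys H"
  using p
proof (induction rule: trig_polys_induct)
  case (add_monomial p a s)
  have "(\<lambda>\<gamma>. a * pairing \<gamma> s * q \<gamma>) \<in> trig_polys H"
    by (rule trig_polys_monomial_mult[OF q]) (use H add_monomial in \<open>auto simp: add_subgroup_def\<close>)
  then have "(\<lambda>\<gamma>. p \<gamma> * q \<gamma> + a * pairing \<gamma> s * q \<gamma>) \<in> trig_polys H"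
    by (rule trig_polys_add[OF add_monomial.IH])
  then show ?case by (simp add: distrib_right)
qed (simp add: trig_polys_zero)

lemma trig_polys_bounded: "p \<in> trig_polys S \<Longrightarrow> \<exists>M. \<forall>\<gamma>. norm (p \<gamma>) \<le> M"
proof (induction rule: trig_polys_induct)
  case (add_monomial q a s)
  then obtain M where "\<forall>\<gamma>. norm (q \<gamma>) \<le> M" by blast
  then have "norm (q \<gamma> + a * pairing \<gamma> s) \<le> M + norm a" for \<gamma>
    by (intro norm_triangle_mono) (simp_all add: norm_mult)
  then show ?case by blast
qed (rule exI[of _ 0], simp)

lemma trig_polys_continuous: "p \<in> trig_polys S \<Longrightarrow> continuous_on A p"
  by (auto simp: trig_polys_def intro!: continuous_intros continuous_on_pairing_left)

text \<open>
  The real-valued elements of \<open>P(H)\<close> form an algebra containing \<open>Re \<langle>\<cdot>, y\<rangle>\<close> and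
  \<open>Im \<langle>\<cdot>, y\<rangle>\<close> for \<open>y \<in> H\<close>. It therefore distinguishes two characters exactly when
  they differ by an element outside the annihilator of \<open>H\<close>.
\<close>
lemma trig_polys_real_approx:
  fixes g :: "'a :: topological_ab_group_add dual_group \<Rightarrow> real"
  assumes H: "add_subgroup H" and K: "compact K" and g: "continuous_on K g"
    and factor: "\<And>\<gamma> \<delta>. \<gamma> \<in> K \<Longrightarrow> \<delta> \<in> K \<Longrightarrow> \<gamma> - \<delta> \<in> annihilator H \<Longrightarrow> g \<gamma> = g \<delta>"
    and gb: "\<And>\<gamma>. \<gamma> \<in> K \<Longrightarrow> \<bar>g \<gamma>\<bar> \<le> c" and "c \<ge> 0" "\<epsilon> > 0"
  obtains p where "(\<lambda>\<gamma>. complex_of_real (p \<gamma>)) \<in> trig_polys H"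
    "\<And>\<gamma>. \<gamma> \<in> K \<Longrightarrow> \<bar>p \<gamma> - g \<gamma>\<bar> < \<epsilon>" "\<And>\<gamma>. \<bar>p \<gamma>\<bar> < c + \<epsilon>"
proof -
  define R where "R = {p. (\<lambda>\<gamma>. complex_of_real (p \<gamma>)) \<in> trig_polys H}"
  have H0: "0 \<in> H" using H by (simp add: add_subgroup_def)
  show thesis
  proof (rule Stone_Weierstrass_factoring_bounded[OF K, of R g c \<epsilon>])
    fix p assume "p \<in> R"
    then have p: "(\<lambda>\<gamma>. complex_of_real (p \<gamma>)) \<in> trig_polys H" by (simp add: R_def)
    show "continuous_on K p"
      using continuous_on_Re[OF trig_polys_continuous[OF p]] by simp
    show "\<exists>M. \<forall>\<gamma>. \<bar>p \<gamma>\<bar> \<le> M" using trig_polys_bounded[OF p] by simp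
  next
    fix \<gamma> \<delta> assume KK: "\<gamma> \<in> K" "\<delta> \<in> K" and eq: "\<forall>f\<in>R. f \<gamma> = f \<delta>"
    have "pairing \<gamma> y = pairing \<delta> y" if y: "y \<in> H" for y
    proof -
      have ym: "- y \<in> H" using H y by (simp add: add_subgroup_def)
      have mono: "(\<lambda>\<gamma>. a * pairing \<gamma> y + b * pairing \<gamma> (- y)) \<in> trig_polys H" for a b
        using trig_polys_add_monomial[OF trig_polys_add_monomial[OF trig_polys_zero y] ym] by simp
      have coords: "complex_of_real (Re (pairing \<gamma> y)) = 1/2 * pairing \<gamma> y + 1/2 * pairing \<gamma> (- y)"
        "complex_of_real (Im (pairing \<gamma> y)) = (- \<i>/2) * pairing \<gamma> y + (\<i>/2) * pairing \<gamma> (- y)" for \<gamma>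
        by (auto simp: pairing_uminus_right complex_eq_iff)
      have "(\<lambda>\<gamma>. Re (pairing \<gamma> y)) \<in> R" "(\<lambda>\<gamma>. Im (pairing \<gamma> y)) \<in> R"
        unfolding R_def mem_Collect_eq coords by (rule mono)+
      from this[THEN eq[rule_format]] show ?thesis by (rule complex_eqI)
    qed
    then have "\<gamma> - \<delta> \<in> annihilator H" by (simp add: annihilator_def pairing_diff pairing_mult_cnj)
    then show "g \<gamma> = g \<delta>" using factor KK by blast
  next
    fix p assume "p \<in> R" "\<And>\<gamma>. \<gamma> \<in> K \<Longrightarrow> \<bar>p \<gamma> - g \<gamma>\<bar> < \<epsilon>" "\<And>\<gamma>. \<bar>p \<gamma>\<bar> < c + \<epsilon>"
    then show thesis using that unfolding R_def by blast
  next
    fix p q assume "p \<in> R" "q \<in> R"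
    then show "(\<lambda>\<gamma>. p \<gamma> + q \<gamma>) \<in> R" "(\<lambda>\<gamma>. p \<gamma> * q \<gamma>) \<in> R"
      unfolding R_def mem_Collect_eq of_real_add of_real_mult
      by (auto intro: trig_polys_add trig_polys_mult[OF H])
  next
    show "(\<lambda>_. a) \<in> R" for a unfolding R_def mem_Collect_eq by (rule trig_polys_const[OF H0])
  qed (fact g gb \<open>c \<ge> 0\<close> \<open>\<epsilon> > 0\<close>)+
qed

lemma trig_polys_approx:
  fixes g :: "'a :: topological_ab_group_add dual_group \<Rightarrow> complex"
  assumes H: "add_subgroup H" and K: "compact K" and g: "continuous_on K g"
    and factor: "\<And>\<gamma> \<delta>. \<gamma> \<in> K \<Longrightarrow> \<delta> \<in> K \<Longrightarrow> \<gamma> - \<delta> \<in> annihilator H \<Longrightarrow> g \<gamma> = g \<delta>"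
    and gb: "\<And>\<gamma>. \<gamma> \<in> K \<Longrightarrow> norm (g \<gamma>) \<le> c" and "c \<ge> 0" "\<epsilon> > 0"
  obtains p where "p \<in> trig_polys H"
    "\<And>\<gamma>. \<gamma> \<in> K \<Longrightarrow> norm (p \<gamma> - g \<gamma>) < \<epsilon>" "\<And>\<gamma>. norm (p \<gamma>) < 2 * c + \<epsilon>"
proof -
  have e2: "\<epsilon>/2 > 0" using \<open>\<epsilon> > 0\<close> by simp
  obtain u where u: "(\<lambda>\<gamma>. complex_of_real (u \<gamma>)) \<in> trig_polys H"
    "\<And>\<gamma>. \<gamma> \<in> K \<Longrightarrow> \<bar>u \<gamma> - Re (g \<gamma>)\<bar> < \<epsilon>/2" "\<And>\<gamma>. \<bar>u \<gamma>\<bar> < c + \<epsilon>/2"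
    by (rule trig_polys_real_approx[OF H K continuous_on_Re[OF g] _ _ \<open>c \<ge> 0\<close> e2])
      (auto intro: order.trans[OF abs_Re_le_cmod gb] arg_cong[OF factor, of _ _ Re])
  obtain v where v: "(\<lambda>\<gamma>. complex_of_real (v \<gamma>)) \<in> trig_polys H"
    "\<And>\<gamma>. \<gamma> \<in> K \<Longrightarrow> \<bar>v \<gamma> - Im (g \<gamma>)\<bar> < \<epsilon>/2" "\<And>\<gamma>. \<bar>v \<gamma>\<bar> < c + \<epsilon>/2"
    by (rule trig_polys_real_approx[OF H K continuous_on_Im[OF g] _ _ \<open>c \<ge> 0\<close> e2])
      (auto intro: order.trans[OF abs_Im_le_cmod gb] arg_cong[OF factor, of _ _ Im])
  show thesis
  proof
    have "(\<lambda>_. \<i>) \<in> trig_polys H" using H by (intro trig_polys_const) (simp add: add_subgroup_def)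
    then show "(\<lambda>\<gamma>. complex_of_real (u \<gamma>) + \<i> * complex_of_real (v \<gamma>)) \<in> trig_polys H"
      by (intro trig_polys_add trig_polys_mult u(1) v(1) H)
    show "norm (complex_of_real (u \<gamma>) + \<i> * complex_of_real (v \<gamma>) - g \<gamma>) < \<epsilon>" if "\<gamma> \<in> K" for \<gamma>
      using u(2)[OF that] v(2)[OF that]
        cmod_le[of "complex_of_real (u \<gamma>) + \<i> * complex_of_real (v \<gamma>) - g \<gamma>"] by simp
    show "norm (complex_of_real (u \<gamma>) + \<i> * complex_of_real (v \<gamma>)) < 2 * c + \<epsilon>" for \<gamma>
      using u(3)[of \<gamma>] v(3)[of \<gamma>]
        cmod_le[of "complex_of_real (u \<gamma>) + \<i> * complex_of_real (v \<gamma>)"] by simp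
  qed
qed

section \<open>Closures of trigonometric polynomials in \<open>L\<^sup>\<alpha>\<close>\<close>

text \<open>The integral itself determines the same closure as the metric, which removes the distinction
  between \<open>\<alpha> \<ge> 1\<close> and \<open>\<alpha> < 1\<close>.\<close>
lemma Lalpha_closure_iff:
  assumes "\<alpha> > 0"
  shows "f \<in> Lalpha_closure \<alpha> \<mu> A \<longleftrightarrow>
    f \<in> Lalpha \<alpha> \<mu> \<and> (\<forall>\<eta>>0. \<exists>g\<in>A. (\<integral>\<gamma>. norm (f \<gamma> - g \<gamma>) powr \<alpha> \<partial>\<mu>) < \<eta>)"
proof -
  define I where "I g = (\<integral>\<gamma>. norm (f \<gamma> - g \<gamma>) powr \<alpha> \<partial>\<mu>)" for g
  have I0: "I g \<ge> 0" for g by (simp add: I_def)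
  have less: "Lalpha_dist \<alpha> \<mu> f g < \<delta> \<longleftrightarrow> I g < (if \<alpha> \<ge> 1 then \<delta> powr \<alpha> else \<delta>)" if "\<delta> > 0" for g \<delta>
  proof (cases "\<alpha> \<ge> 1")
    case True
    have "I g powr (1/\<alpha>) < (\<delta> powr \<alpha>) powr (1/\<alpha>) \<longleftrightarrow> I g < \<delta> powr \<alpha>"
      using assms I0 by (meson powr_less_mono2 powr_mono2 not_le zero_less_divide_1_iff powr_ge_zero less_imp_le)
    then show ?thesis using True that by (simp add: Lalpha_dist_def I_def powr_powr)
  qed (simp add: Lalpha_dist_def I_def)
  have "(\<forall>\<epsilon>>0. \<exists>g\<in>A. Lalpha_dist \<alpha> \<mu> f g < \<epsilon>) \<longleftrightarrow> (\<forall>\<eta>>0. \<exists>g\<in>A. I g < \<eta>)"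
  proof safe
    fix \<eta> :: real assume \<eta>: "\<eta> > 0" and *: "\<forall>\<epsilon>>0. \<exists>g\<in>A. Lalpha_dist \<alpha> \<mu> f g < \<epsilon>"
    define \<delta> where "\<delta> = (if \<alpha> \<ge> 1 then \<eta> powr (1/\<alpha>) else \<eta>)"
    have \<delta>: "\<delta> > 0" using \<eta> by (simp add: \<delta>_def)
    then obtain g where "g \<in> A" "Lalpha_dist \<alpha> \<mu> f g < \<delta>" using * by blast
    then show "\<exists>g\<in>A. I g < \<eta>"
      using less[OF \<delta>] assms \<eta> by (auto simp: \<delta>_def powr_powr split: if_splits)
  next
    fix \<epsilon> :: real assume \<epsilon>: "\<epsilon> > 0" and *: "\<forall>\<eta>>0. \<exists>g\<in>A. I g < \<eta>"
    have "(if \<alpha> \<ge> 1 then \<epsilon> powr \<alpha> else \<epsilon>) > 0" using \<epsilon> by simp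
    then show "\<exists>g\<in>A. Lalpha_dist \<alpha> \<mu> f g < \<epsilon>" using * less[OF \<epsilon>] by blast
  qed
  then show ?thesis by (simp add: Lalpha_closure_def I_def)
qed

lemma Lalpha_diff_integrable:
  assumes f: "f \<in> Lalpha \<alpha> \<mu>" and g: "g \<in> Lalpha \<alpha> \<mu>" and "\<alpha> > 0"
  shows "integrable \<mu> (\<lambda>\<gamma>. norm (f \<gamma> - g \<gamma>) powr \<alpha>)"
proof (rule Bochner_Integration.integrable_bound)
  show "integrable \<mu> (\<lambda>\<gamma>. 2 powr \<alpha> * (norm (f \<gamma>) powr \<alpha> + norm (g \<gamma>) powr \<alpha>))"
    using f g by (auto simp: Lalpha_def)
  show "(\<lambda>\<gamma>. norm (f \<gamma> - g \<gamma>) powr \<alpha>) \<in> borel_measurable \<mu>"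
    using f g by (auto simp: Lalpha_def)
  have "norm (f \<gamma> - g \<gamma>) powr \<alpha> \<le> 2 powr \<alpha> * (norm (f \<gamma>) powr \<alpha> + norm (g \<gamma>) powr \<alpha>)" for \<gamma>
  proof -
    have "norm (f \<gamma> - g \<gamma>) \<le> 2 * max (norm (f \<gamma>)) (norm (g \<gamma>))"
      using norm_triangle_ineq4[of "f \<gamma>" "g \<gamma>"] by simp
    then have "norm (f \<gamma> - g \<gamma>) powr \<alpha> \<le> (2 * max (norm (f \<gamma>)) (norm (g \<gamma>))) powr \<alpha>"
      using \<open>\<alpha> > 0\<close> by (intro powr_mono2) auto
    also have "\<dots> = 2 powr \<alpha> * max (norm (f \<gamma>)) (norm (g \<gamma>)) powr \<alpha>"
      by (rule powr_mult) 
    also have "\<dots> \<le> 2 powr \<alpha> * (norm (f \<gamma>) powr \<alpha> + norm (g \<gamma>) powr \<alpha>)"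
      by (intro mult_left_mono) (auto simp: max_def)
    finally show ?thesis .
  qed
  then show "AE \<gamma> in \<mu>. norm (norm (f \<gamma> - g \<gamma>) powr \<alpha>) \<le>
      norm (2 powr \<alpha> * (norm (f \<gamma>) powr \<alpha> + norm (g \<gamma>) powr \<alpha>))"
    by simp
qed

lemma Lalpha_closure_AE_limit:
  assumes f: "f \<in> Lalpha_closure \<alpha> \<mu> A" and A: "A \<subseteq> Lalpha \<alpha> \<mu>" and "\<alpha> > 0"
  obtains p :: "nat \<Rightarrow> _" where "\<And>n. p n \<in> A" "AE \<gamma> in \<mu>. (\<lambda>n. p n \<gamma>) \<longlonglongrightarrow> f \<gamma>"
proof -
  have "\<exists>g\<in>A. (\<integral>\<gamma>. norm (f \<gamma> - g \<gamma>) powr \<alpha> \<partial>\<mu>) < 1 / Suc n" for n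
    using f unfolding Lalpha_closure_iff[OF \<open>\<alpha> > 0\<close>] by simp
  then obtain p where p: "\<And>n. p n \<in> A" "\<And>n. (\<integral>\<gamma>. norm (f \<gamma> - p n \<gamma>) powr \<alpha> \<partial>\<mu>) < 1 / Suc n"
    by metis
  define u where "u n \<gamma> = norm (f \<gamma> - p n \<gamma>) powr \<alpha>" for n \<gamma>
  have "integrable \<mu> (u n)" for n
    unfolding u_def using f p(1) A \<open>\<alpha> > 0\<close>
    by (intro Lalpha_diff_integrable) (auto simp: Lalpha_closure_def)
  moreover have "(\<lambda>n. \<integral>\<gamma>. norm (u n \<gamma>) \<partial>\<mu>) \<longlonglongrightarrow> 0"
  proof (rule tendsto_sandwich[OF _ _ tendsto_const LIMSEQ_inverse_real_of_nat])
    show "\<forall>\<^sub>F n in sequentially. (\<integral>\<gamma>. norm (u n \<gamma>) \<partial>\<mu>) \<le> inverse (real (Suc n))"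
      using p(2) by (intro always_eventually allI less_imp_le) (simp add: u_def inverse_eq_divide)
  qed (simp add: u_def)
  ultimately obtain r where "AE \<gamma> in \<mu>. (\<lambda>n. u (r n) \<gamma>) \<longlonglongrightarrow> 0"
    using tendsto_L1_AE_subseq[of \<mu> u] by blast
  then have "AE \<gamma> in \<mu>. (\<lambda>n. p (r n) \<gamma>) \<longlonglongrightarrow> f \<gamma>"
  proof eventually_elim
    case (elim \<gamma>)
    have "(\<lambda>n. u (r n) \<gamma> powr (1/\<alpha>)) \<longlonglongrightarrow> 0"
      by (rule tendsto_zero_powrI[OF elim tendsto_const]) (use \<open>\<alpha> > 0\<close> in \<open>auto simp: u_def\<close>)
    then have "(\<lambda>n. norm (f \<gamma> - p (r n) \<gamma>)) \<longlonglongrightarrow> 0"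
      using \<open>\<alpha> > 0\<close> by (simp add: u_def powr_powr)
    from tendsto_diff[OF tendsto_const tendsto_norm_zero_cancel[OF this], of "f \<gamma>"]
    show ?case by simp
  qed
  then show thesis using p(1) that[of "\<lambda>n. p (r n)"] by blast
qed

text \<open>On \<open>x + H\<close> a character \<open>l\<close> that is trivial on \<open>H\<close> takes the single value \<open>\<langle>l, x\<rangle>\<close>,
  so translation by \<open>l\<close> scales all terms of \<open>p\<close> alike.\<close>
lemma trig_polys_coset_translate:
  assumes "p \<in> trig_polys ((+) x ` H)" "l \<in> annihilator H"
  shows "p (\<gamma> + l) = pairing l x * p \<gamma>"
  using assms(1)
proof (induction rule: trig_polys_induct)
  case (add_monomial q a s)
  then obtain y where "y \<in> H" "s = x + y" by blast
  then have "pairing l s = pairing l x"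
    using assms(2) by (simp add: annihilator_def pairing_add_right)
  then show ?case using add_monomial.IH by (simp add: pairing_plus algebra_simps)
qed simp

text \<open>The exceptional set covers the points where a fixed sequence of approximating polynomials
  fails to converge to \<open>f\<close>, so it serves all \<open>l\<close> at once.\<close>
lemma Lalpha_closure_coset_equivariant:
  fixes H :: "'a :: topological_ab_group_add set"
  assumes \<mu>: "regular_borel_measure \<mu>" and "\<alpha> > 0"
    and f: "f \<in> Lalpha_closure \<alpha> \<mu> (trig_polys ((+) x ` H))"
  obtains N where "N \<in> null_sets \<mu>"
    "\<And>\<gamma> l. l \<in> annihilator H \<Longrightarrow> \<gamma> \<notin> N \<Longrightarrow> \<gamma> + l \<notin> N \<Longrightarrow> f (\<gamma> + l) = pairing l x * f \<gamma>"
proof -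
  obtain p where p: "\<And>n. p n \<in> trig_polys ((+) x ` H)" "AE \<gamma> in \<mu>. (\<lambda>n::nat. p n \<gamma>) \<longlonglongrightarrow> f \<gamma>"
    using Lalpha_closure_AE_limit[OF f trig_polys_subset_Lalpha[OF \<mu> \<open>\<alpha> > 0\<close>] \<open>\<alpha> > 0\<close>] by blast
  obtain N where N: "{\<gamma> \<in> space \<mu>. \<not> (\<lambda>n. p n \<gamma>) \<longlonglongrightarrow> f \<gamma>} \<subseteq> N" "N \<in> null_sets \<mu>"
    using p(2) by (auto elim!: AE_E)
  have "sets \<mu> = sets borel" using \<mu> by (simp add: regular_borel_measure_def)
  then have space: "space \<mu> = UNIV" using sets_eq_imp_space_eq by fastforce
  show thesis
  proof (rule that[OF N(2)])
    fix \<gamma> l assume l: "l \<in> annihilator H" and "\<gamma> \<notin> N" "\<gamma> + l \<notin> N"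
    then have "(\<lambda>n. p n \<gamma>) \<longlonglongrightarrow> f \<gamma>" "(\<lambda>n. p n (\<gamma> + l)) \<longlonglongrightarrow> f (\<gamma> + l)"
      using N(1) space by auto
    then have "(\<lambda>n. pairing l x * p n \<gamma>) \<longlonglongrightarrow> pairing l x * f \<gamma>" "(\<lambda>n. pairing l x * p n \<gamma>) \<longlonglongrightarrow> f (\<gamma> + l)"
      by (auto intro: tendsto_mult_left simp: trig_polys_coset_translate[OF p(1) l])
    then show "f (\<gamma> + l) = pairing l x * f \<gamma>" using LIMSEQ_unique by blast
  qed
qed

text \<open>
  The closures of \<open>P(H)\<close> and \<open>P(x + H)\<close> give \<open>f(\<gamma> + l) = f(\<gamma>)\<close> and
  \<open>f(\<gamma> + l) = \<langle>l, x\<rangle> f(\<gamma>)\<close> off a null set. Since \<open>l \<noteq> 0\<close>, some \<open>x\<close> has \<open>\<langle>l, x\<rangle> \<noteq> 1\<close>.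
  One such \<open>x\<close> for each of the countably many \<open>l\<close> suffices, so a null set remains.
\<close>
lemma Lalpha_closure_Inter_vanishes:
  fixes H :: "'a :: topological_ab_group_add set"
  assumes \<mu>: "regular_borel_measure \<mu>" and "\<alpha> > 0" and c: "countable (annihilator H)"
    and f: "f \<in> (\<Inter>S\<in>cosets H. Lalpha_closure \<alpha> \<mu> (trig_polys S))"
  obtains N where "N \<in> null_sets \<mu>"
    "\<And>\<gamma> l. l \<in> annihilator H \<Longrightarrow> l \<noteq> 0 \<Longrightarrow> \<gamma> \<notin> N \<Longrightarrow> \<gamma> + l \<notin> N \<Longrightarrow> f \<gamma> = 0"
proof -
  have "f \<in> Lalpha_closure \<alpha> \<mu> (trig_polys ((+) x ` H))" for x
    using f by (auto simp: cosets_def)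
  then have "\<exists>N. N \<in> null_sets \<mu> \<and> (\<forall>\<gamma> l. l \<in> annihilator H \<longrightarrow> \<gamma> \<notin> N \<longrightarrow> \<gamma> + l \<notin> N \<longrightarrow>
      f (\<gamma> + l) = pairing l x * f \<gamma>)" for x
    using Lalpha_closure_coset_equivariant[OF \<mu> \<open>\<alpha> > 0\<close>] by metis
  then obtain N where N: "\<And>x. N x \<in> null_sets \<mu>"
    "\<And>x \<gamma> l. l \<in> annihilator H \<Longrightarrow> \<gamma> \<notin> N x \<Longrightarrow> \<gamma> + l \<notin> N x \<Longrightarrow> f (\<gamma> + l) = pairing l x * f \<gamma>"
    by metis
  have "\<exists>x. pairing l x \<noteq> 1" if "l \<noteq> 0" for l :: "'a dual_group"
    using that by (auto simp: pairing_inject[symmetric] fun_eq_iff pairing_0)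
  then obtain X where X: "\<And>l :: 'a dual_group. l \<noteq> 0 \<Longrightarrow> pairing l (X l) \<noteq> 1" by metis
  show thesis
  proof (rule that[of "N 0 \<union> (\<Union>l\<in>annihilator H. N (X l))"])
    show "N 0 \<union> (\<Union>l\<in>annihilator H. N (X l)) \<in> null_sets \<mu>"
      using N(1) c by (auto intro!: null_sets.Un null_sets_UN')
    fix \<gamma> l assume l: "l \<in> annihilator H" "l \<noteq> 0"
      and "\<gamma> \<notin> N 0 \<union> (\<Union>l\<in>annihilator H. N (X l))" "\<gamma> + l \<notin> N 0 \<union> (\<Union>l\<in>annihilator H. N (X l))"
    then have "f (\<gamma> + l) = f \<gamma>" "f (\<gamma> + l) = pairing l (X l) * f \<gamma>"
      using N(2)[OF l(1), of \<gamma> 0] N(2)[OF l(1), of \<gamma> "X l"] by (auto simp: pairing_0_right)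
    then show "f \<gamma> = 0" using X[OF l(2)] by simp
  qed
qed

text \<open>
  Regularity yields compact sets \<open>K1 \<subseteq> B\<close> and \<open>K2\<close> in the complement of all translates of \<open>B\<close>
  that together carry almost all of \<open>\<mu>\<close>. The function equal to \<open>\<langle>\<cdot>, -x\<rangle>\<close> on \<open>K1\<close> and
  to \<open>0\<close> on \<open>K2\<close> is continuous on their union and constant on cosets of the annihilator there, so
  it has an approximant in \<open>P(H)\<close>; multiplying it by \<open>\<langle>\<cdot>, x\<rangle>\<close> gives an approximant of the
  indicator in \<open>P(x + H)\<close>.
\<close>
lemma indicator_in_Lalpha_closure:
  fixes H :: "'a :: topological_ab_group_add set"
  assumes \<mu>: "regular_borel_measure \<mu>" and "\<alpha> > 0" and H: "add_subgroup H"
    and c: "countable (annihilator H)" and B: "B \<in> sets borel"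
    and disj: "\<And>l. l \<in> annihilator H \<Longrightarrow> l \<noteq> 0 \<Longrightarrow> B \<inter> (\<lambda>\<gamma>. \<gamma> + l) ` B = {}"
    and null: "\<And>l. l \<in> annihilator H \<Longrightarrow> l \<noteq> 0 \<Longrightarrow> (\<lambda>\<gamma>. \<gamma> + l) ` B \<in> null_sets \<mu>"
  shows "(indicator B :: _ \<Rightarrow> complex) \<in> Lalpha_closure \<alpha> \<mu> (trig_polys ((+) x ` H))"
  unfolding Lalpha_closure_iff[OF \<open>\<alpha> > 0\<close>]
proof (intro conjI allI impI)
  interpret finite_measure \<mu> using \<mu> by (simp add: regular_borel_measure_def)
  have sets: "sets \<mu> = sets borel" using \<mu> by (simp add: regular_borel_measure_def)
  then have space: "space \<mu> = UNIV" using sets_eq_imp_space_eq by fastforce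
  have ind: "(indicator B :: _ \<Rightarrow> complex) \<in> borel_measurable \<mu>"
    using B sets by (simp add: borel_measurable_indicator)
  have "integrable \<mu> (\<lambda>\<gamma>. norm (indicator B \<gamma> :: complex) powr \<alpha>)"
  proof (intro integrable_const_bound[of _ 1] AE_I2)
    show "(\<lambda>\<gamma>. norm (indicator B \<gamma> :: complex) powr \<alpha>) \<in> borel_measurable \<mu>"
      using ind by measurable
  qed (simp add: indicator_def)
  with ind show L: "(indicator B :: _ \<Rightarrow> complex) \<in> Lalpha \<alpha> \<mu>"
    by (simp add: Lalpha_def)
  have compact_approx: "\<exists>K. compact K \<and> K \<subseteq> D \<and> measure \<mu> (D - K) < \<epsilon>"
    if D: "D \<in> sets borel" and "\<epsilon> > 0" for D \<epsilon>
  proof -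
    obtain K U where KU: "compact K" "open U" "K \<subseteq> D" "D \<subseteq> U" "measure \<mu> (U - K) < \<epsilon>"
      using \<mu> D \<open>\<epsilon> > 0\<close> unfolding regular_borel_measure_def by meson
    have "measure \<mu> (D - K) \<le> measure \<mu> (U - K)"
      using KU(4) borel_open[OF KU(2)] borel_compact[OF KU(1)] by (intro finite_measure_mono) (auto simp: sets)
    with KU show ?thesis by (intro exI[of _ K]) auto
  qed
  fix \<eta> :: real assume "\<eta> > 0"
  define M where "M = measure \<mu> UNIV"
  \<comment> \<open>The error will be at most \<open>\<epsilon>\<close> on a compact set and at most \<open>4\<close> off it, on a set of
    measure less than \<open>\<epsilon>\<close>.\<close>
  have "((\<lambda>\<epsilon>. \<epsilon> powr \<alpha>) \<longlongrightarrow> 0) (at_right 0)"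
    using \<open>\<alpha> > 0\<close>
    by (intro tendsto_zero_powrI[of _ _ _ \<alpha>] tendsto_const tendsto_ident_at) (auto simp: eventually_at_filter)
  then have "((\<lambda>\<epsilon>. \<epsilon> powr \<alpha> * M + 4 powr \<alpha> * \<epsilon>) \<longlongrightarrow> 0 * M + 4 powr \<alpha> * 0) (at_right (0::real))"
    by (intro tendsto_intros)
  then have "\<forall>\<^sub>F \<epsilon> in at_right 0. \<epsilon> powr \<alpha> * M + 4 powr \<alpha> * \<epsilon> < \<eta>"
    using \<open>\<eta> > 0\<close> by (intro order_tendstoD) auto
  moreover have "\<forall>\<^sub>F \<epsilon> in at_right 0. (\<epsilon>::real) \<in> {0<..<1}"
    by (rule eventually_at_right_real) simp
  ultimately have "\<forall>\<^sub>F \<epsilon> in at_right 0. \<epsilon> powr \<alpha> * M + 4 powr \<alpha> * \<epsilon> < \<eta> \<and> \<epsilon> \<in> {0<..<1}"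
    by (rule eventually_conj)
  from eventually_happens[OF this] obtain \<epsilon>
    where \<epsilon>: "\<epsilon> powr \<alpha> * M + 4 powr \<alpha> * \<epsilon> < \<eta>" "0 < \<epsilon>" "\<epsilon> < 1"
    by auto
  \<comment> \<open>The other translates of \<open>B\<close> are null and can be left out of the compact set.\<close>
  define D where "D = (\<Union>l\<in>annihilator H - {0}. (\<lambda>\<gamma>. \<gamma> + l) ` B)"
  have D: "D \<in> null_sets \<mu>"
    unfolding D_def using c null by (intro null_sets_UN') auto
  have Dm: "D \<in> sets borel" using D sets by auto
  have BD: "B \<inter> D = {}" using disj by (auto simp: D_def)
  obtain K1 where K1: "compact K1" "K1 \<subseteq> B" "measure \<mu> (B - K1) < \<epsilon>/2"
    using compact_approx[OF B, of "\<epsilon>/2"] \<epsilon> by auto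
  obtain K2 where K2: "compact K2" "K2 \<subseteq> - (B \<union> D)" "measure \<mu> (- (B \<union> D) - K2) < \<epsilon>/2"
    using compact_approx[of "- (B \<union> D)" "\<epsilon>/2"] \<epsilon> B Dm by auto
  define K where "K = K1 \<union> K2"
  have K: "compact K" unfolding K_def by (intro compact_Un K1 K2)
  have Km: "K1 \<in> sets borel" "K2 \<in> sets borel" "K \<in> sets borel"
    using K1 K2 K by (auto intro: borel_compact)
  have m: "B - K1 \<in> sets \<mu>" "- (B \<union> D) - K2 \<in> sets \<mu>" "D \<in> sets \<mu>"
    unfolding sets by (intro sets.Diff borel_comp sets.Un Km B Dm)+
  have "- K \<subseteq> (B - K1) \<union> (- (B \<union> D) - K2) \<union> D" by (auto simp: K_def)
  then have "measure \<mu> (- K) \<le> measure \<mu> ((B - K1) \<union> (- (B \<union> D) - K2) \<union> D)"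
    by (intro finite_measure_mono sets.Un m)
  also have "\<dots> \<le> measure \<mu> (B - K1) + measure \<mu> (- (B \<union> D) - K2) + measure \<mu> D"
    by (intro order.trans[OF measure_Un_le] add_right_mono measure_Un_le
        sets.Un m)
  also have "\<dots> < \<epsilon>" using K1(3) K2(3) D by (simp add: null_sets_def measure_def)
  finally have small: "measure \<mu> (- K) < \<epsilon>" .
  define g where "g \<gamma> = (if \<gamma> \<in> K1 then cnj (pairing \<gamma> x) else 0)" for \<gamma>
  have K12: "K1 \<inter> K2 = {}" using K1(2) K2(2) by auto
  have g: "continuous_on K g"
    unfolding K_def g_def using K12 K1(1) K2(1)
    by (intro continuous_on_cases compact_imp_closed continuous_on_cnj continuous_on_pairing_left
        continuous_on_const) auto
  have orbit: "\<gamma> = \<delta> \<or> \<delta> \<in> D" if "\<gamma> \<in> B" "\<delta> - \<gamma> \<in> annihilator H" for \<gamma> \<delta>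
  proof (cases "\<delta> - \<gamma> = 0")
    case False
    then have "\<gamma> + (\<delta> - \<gamma>) \<in> D" unfolding D_def using that by blast
    then show ?thesis by simp
  qed simp
  have factor: "g \<gamma> = g \<delta>" if "\<gamma> \<in> K" "\<delta> \<in> K" "\<gamma> - \<delta> \<in> annihilator H" for \<gamma> \<delta>
  proof -
    have KD: "K \<inter> D = {}" using K1(2) K2(2) BD by (auto simp: K_def)
    have "- (\<gamma> - \<delta>) \<in> annihilator H"
      using that(3) add_subgroup_annihilator[of H] unfolding add_subgroup_def by blast
    then have "\<delta> - \<gamma> \<in> annihilator H" by simp
    then have "\<gamma> = \<delta> \<or> \<gamma> \<notin> B \<and> \<delta> \<notin> B"
      using orbit[of \<gamma> \<delta>] orbit[of \<delta> \<gamma>] that KD by auto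
    then show ?thesis using K1(2) by (auto simp: g_def)
  qed
  obtain p where p: "p \<in> trig_polys H" "\<And>\<gamma>. \<gamma> \<in> K \<Longrightarrow> norm (p \<gamma> - g \<gamma>) < \<epsilon>"
      "\<And>\<gamma>. norm (p \<gamma>) < 2 * 1 + \<epsilon>"
    by (rule trig_polys_approx[OF H K g factor, of 1 \<epsilon>]) (use \<epsilon> in \<open>auto simp: g_def\<close>)
  define q where "q \<gamma> = 1 * pairing \<gamma> x * p \<gamma>" for \<gamma>
  have q: "q \<in> trig_polys ((+) x ` H)"
    unfolding q_def by (rule trig_polys_monomial_mult[OF p(1)]) simp
  have qK: "norm (indicator B \<gamma> - q \<gamma>) < \<epsilon>" if "\<gamma> \<in> K" for \<gamma>
  proof -
    have "indicator B \<gamma> = pairing \<gamma> x * g \<gamma>"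
      using that K1(2) K2(2) by (auto simp: g_def K_def pairing_mult_cnj)
    then have "indicator B \<gamma> - q \<gamma> = pairing \<gamma> x * (g \<gamma> - p \<gamma>)"
      by (simp add: q_def algebra_simps)
    then show ?thesis using p(2)[OF that] by (simp add: norm_mult norm_minus_commute)
  qed
  \<comment> \<open>\<open>\<bar>q\<bar> < 2 + \<epsilon> < 3\<close> by the global bound on \<open>p\<close>, and the indicator adds at most \<open>1\<close>.\<close>
  have q4: "norm (indicator B \<gamma> - q \<gamma>) \<le> 4" for \<gamma>
  proof -
    have "norm (q \<gamma>) \<le> 3" using p(3)[of \<gamma>] \<epsilon> by (simp add: q_def norm_mult)
    moreover have "norm (indicator B \<gamma> :: complex) \<le> 1" by (simp add: indicator_def)
    ultimately show ?thesis using norm_triangle_ineq4[of "indicator B \<gamma>" "q \<gamma>"] by linarith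
  qed
  have "(\<integral>\<gamma>. norm (indicator B \<gamma> - q \<gamma>) powr \<alpha> \<partial>\<mu>) \<le>
      (\<integral>\<gamma>. \<epsilon> powr \<alpha> + 4 powr \<alpha> * indicator (- K) \<gamma> \<partial>\<mu>)"
  proof (rule integral_mono)
    show "integrable \<mu> (\<lambda>\<gamma>. norm (indicator B \<gamma> - q \<gamma>) powr \<alpha>)"
      using L q trig_polys_subset_Lalpha[OF \<mu> \<open>\<alpha> > 0\<close>] \<open>\<alpha> > 0\<close> by (intro Lalpha_diff_integrable) auto
    show "integrable \<mu> (\<lambda>\<gamma>. \<epsilon> powr \<alpha> + 4 powr \<alpha> * indicator (- K) \<gamma>)"
      using Km by (auto simp: sets emeasure_finite less_top[symmetric])
    show "norm (indicator B \<gamma> - q \<gamma>) powr \<alpha> \<le> \<epsilon> powr \<alpha> + 4 powr \<alpha> * indicator (- K) \<gamma>" for \<gamma>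
    proof (cases "\<gamma> \<in> K")
      case True
      then show ?thesis using qK[OF True] \<open>\<alpha> > 0\<close> by (auto intro!: powr_mono2)
    next
      case False
      then show ?thesis
        using powr_mono2[OF _ _ q4[of \<gamma>], of \<alpha>] \<open>\<alpha> > 0\<close> by (auto intro: add_increasing)
    qed
  qed
  also have "\<dots> = \<epsilon> powr \<alpha> * M + 4 powr \<alpha> * measure \<mu> (- K)"
    using Km by (subst Bochner_Integration.integral_add)
      (auto simp: sets emeasure_finite less_top[symmetric] M_def space mult.commute)
  also have "\<dots> \<le> \<epsilon> powr \<alpha> * M + 4 powr \<alpha> * \<epsilon>"
    using small by (intro add_left_mono mult_left_mono) auto
  also have "\<dots> < \<eta>" by (rule \<epsilon>(1))
  finally show "\<exists>q\<in>trig_polys ((+) x ` H). (\<integral>\<gamma>. norm (indicator B \<gamma> - q \<gamma>) powr \<alpha> \<partial>\<mu>) < \<eta>"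
    using q by blast
qed

section \<open>Densities and translates of subsets of the transversal\<close>

lemma emeasure_nu_part_translate:
  fixes \<mu> :: "'b :: topological_ab_group_add measure"
  assumes "sets \<mu> = sets borel" "T \<in> sets borel" "A \<in> sets borel" "A \<subseteq> T"
  shows "emeasure (nu_part \<mu> T l) A = emeasure \<mu> ((\<lambda>t. t + l) ` A)"
proof -
  have "(\<lambda>b. l + b) ` A = (\<lambda>t. t + l) ` A" by (simp add: add.commute)
  moreover have "(\<lambda>t. t + l) ` A \<inter> (\<lambda>t. t + l) ` T = (\<lambda>t. t + l) ` A" using assms(4) by blast
  ultimately show ?thesis
    using assms borel_translate[OF assms(3), of l] by (simp add: emeasure_nu_part emeasure_mu_part)
qed

lemma emeasure_nu_sum_single:
  assumes "A \<in> sets borel" "l \<in> L" "\<And>l'. l' \<in> L \<Longrightarrow> l' \<noteq> l \<Longrightarrow> emeasure (nu_part \<mu> T l') A = 0"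
  shows "emeasure (nu_sum \<mu> T L) A = emeasure (nu_part \<mu> T l) A"
  using assms by (subst emeasure_nu_sum, simp, subst nn_integral_count_space'[of "{l}"]) auto

lemma emeasure_nu_sum_ge_pair:
  assumes A: "A \<in> sets borel" and l: "l \<in> L" "l' \<in> L" "l' \<noteq> l"
  shows "emeasure (nu_part \<mu> T l) A + emeasure (nu_part \<mu> T l') A \<le> emeasure (nu_sum \<mu> T L) A"
proof -
  have "emeasure (nu_part \<mu> T l) A + emeasure (nu_part \<mu> T l') A =
      (\<integral>\<^sup>+ k. emeasure (nu_part \<mu> T k) A * indicator {l, l'} k \<partial>count_space L)"
    using l by (subst nn_integral_count_space'[of "{l, l'}"]) auto
  also have "\<dots> \<le> (\<integral>\<^sup>+ k. emeasure (nu_part \<mu> T k) A \<partial>count_space L)"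
    by (intro nn_integral_mono) (auto simp: indicator_def)
  also have "\<dots> = emeasure (nu_sum \<mu> T L) A" using A by (simp add: emeasure_nu_sum)
  finally show ?thesis .
qed

text \<open>
  If every \<open>A + l'\<close> with \<open>l' \<noteq> l\<close> is null, then \<open>\<nu>(A) = \<nu>\<^sub>l(A) = \<integral>\<^sub>A h\<^sub>l d\<nu>\<close>, so \<open>h\<^sub>l < 1\<close> forces
  \<open>\<nu>(A) = 0\<close>. Conversely, on \<open>A = {h\<^sub>l \<ge> 1}\<close> the measure \<open>\<nu>\<^sub>l\<close> already exhausts \<open>\<nu>\<close>, which leaves
  nothing for the other \<open>\<nu>\<^sub>l'\<close>.
\<close>
lemma densities_less_1_iff:
  fixes \<mu> :: "'b :: topological_ab_group_add measure" and h :: "'b \<Rightarrow> 'b \<Rightarrow> real"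
  assumes \<mu>: "finite_measure \<mu>" "sets \<mu> = sets borel" and T: "T \<in> sets borel" and l: "l \<in> L"
    and h: "h l \<in> borel_measurable borel" "\<And>\<gamma>. 0 \<le> h l \<gamma>" "\<And>\<gamma>. \<gamma> \<notin> T \<Longrightarrow> h l \<gamma> = 0"
    and dens: "density (nu_sum \<mu> T L) (\<lambda>\<gamma>. ennreal (h l \<gamma>)) = nu_part \<mu> T l"
  shows "(AE \<gamma> in nu_sum \<mu> T L. h l \<gamma> < 1) \<longleftrightarrow>
    (\<forall>A\<in>sets borel. A \<subseteq> T \<longrightarrow>
      (\<forall>l'\<in>L. l' \<noteq> l \<longrightarrow> (\<lambda>t. t + l') ` A \<in> null_sets \<mu>) \<longrightarrow> (\<lambda>t. t + l) ` A \<in> null_sets \<mu>)"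
proof -
  interpret finite_measure \<mu> by fact
  define \<nu> where "\<nu> = nu_sum \<mu> T L"
  have s [measurable_cong]: "sets \<nu> = sets borel" by (simp add: \<nu>_def)
  then have space: "space \<nu> = UNIV" using sets_eq_imp_space_eq by fastforce
  note h(1) [measurable]
  have part: "emeasure (nu_part \<mu> T l) A = (\<integral>\<^sup>+ \<gamma>. ennreal (h l \<gamma>) * indicator A \<gamma> \<partial>\<nu>)"
    if "A \<in> sets borel" for A
    unfolding dens[symmetric] \<nu>_def[symmetric] using that s by (intro emeasure_density) auto
  have null_iff: "(\<lambda>t. t + k) ` A \<in> null_sets \<mu> \<longleftrightarrow> emeasure (nu_part \<mu> T k) A = 0"
    if "A \<in> sets borel" "A \<subseteq> T" for k A
    using that borel_translate[of A k] by (simp add: emeasure_nu_part_translate[OF \<mu>(2) T] null_sets_def \<mu>(2))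
  have fin: "emeasure (nu_part \<mu> T k) A < \<infinity>" if "A \<in> sets borel" "A \<subseteq> T" for k A
    using that by (simp add: emeasure_nu_part_translate[OF \<mu>(2) T] emeasure_finite less_top[symmetric])
  show ?thesis unfolding \<nu>_def[symmetric]
  proof (intro iffI ballI impI)
    fix A assume lt: "AE \<gamma> in \<nu>. h l \<gamma> < 1" and A: "A \<in> sets borel" "A \<subseteq> T"
      and "\<forall>l'\<in>L. l' \<noteq> l \<longrightarrow> (\<lambda>t. t + l') ` A \<in> null_sets \<mu>"
    then have eq: "emeasure \<nu> A = emeasure (nu_part \<mu> T l) A"
      unfolding \<nu>_def by (intro emeasure_nu_sum_single l) (simp_all add: null_iff)
    note A(1) [measurable]
    have "emeasure \<nu> A = (\<integral>\<^sup>+ \<gamma>. ennreal (1 - h l \<gamma>) * indicator A \<gamma> + ennreal (h l \<gamma>) * indicator A \<gamma> \<partial>\<nu>)"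
    proof -
      have "emeasure \<nu> A = (\<integral>\<^sup>+ \<gamma>. indicator A \<gamma> \<partial>\<nu>)" using A s by simp
      also have "\<dots> = (\<integral>\<^sup>+ \<gamma>. ennreal (1 - h l \<gamma>) * indicator A \<gamma> + ennreal (h l \<gamma>) * indicator A \<gamma> \<partial>\<nu>)"
      proof (rule nn_integral_cong_AE, use lt in eventually_elim)
        case (elim \<gamma>)
        then have "ennreal (1 - h l \<gamma>) + ennreal (h l \<gamma>) = 1"
          using h(2)[of \<gamma>] by (subst ennreal_plus[symmetric]) simp_all
        then show ?case by (simp add: indicator_def)
      qed
      finally show ?thesis .
    qed
    also have "\<dots> = (\<integral>\<^sup>+ \<gamma>. ennreal (1 - h l \<gamma>) * indicator A \<gamma> \<partial>\<nu>) + emeasure \<nu> A"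
      unfolding eq part[OF A(1)] by (intro nn_integral_add) measurable
    finally have "(\<integral>\<^sup>+ \<gamma>. ennreal (1 - h l \<gamma>) * indicator A \<gamma> \<partial>\<nu>) = 0"
      using fin[OF A, of l] by (auto simp: eq)
    then have "AE \<gamma> in \<nu>. ennreal (1 - h l \<gamma>) * indicator A \<gamma> = 0"
      by (subst (asm) nn_integral_0_iff_AE) measurable
    with lt have "AE \<gamma> in \<nu>. \<gamma> \<notin> A"
      by eventually_elim (auto simp: indicator_def ennreal_eq_0_iff split: if_splits)
    then have "emeasure \<nu> A = 0" using A s AE_iff_measurable[of A \<nu> "\<lambda>\<gamma>. \<gamma> \<notin> A"] by (simp add: space)
    then show "(\<lambda>t. t + l) ` A \<in> null_sets \<mu>" using eq null_iff[OF A] by simp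
  next
    assume *: "\<forall>A\<in>sets borel. A \<subseteq> T \<longrightarrow>
      (\<forall>l'\<in>L. l' \<noteq> l \<longrightarrow> (\<lambda>t. t + l') ` A \<in> null_sets \<mu>) \<longrightarrow> (\<lambda>t. t + l) ` A \<in> null_sets \<mu>"
    define A where "A = {\<gamma>. 1 \<le> h l \<gamma>}"
    have A: "A \<in> sets borel" "A \<subseteq> T" unfolding A_def using h(3) by (measurable, force)
    have "emeasure \<nu> A = (\<integral>\<^sup>+ \<gamma>. indicator A \<gamma> \<partial>\<nu>)" using A s by simp
    also have "\<dots> \<le> emeasure (nu_part \<mu> T l) A"
      unfolding part[OF A(1)] by (intro nn_integral_mono) (auto simp: A_def indicator_def)
    finally have le: "emeasure \<nu> A \<le> emeasure (nu_part \<mu> T l) A" .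
    have "(\<lambda>t. t + l') ` A \<in> null_sets \<mu>" if "l' \<in> L" "l' \<noteq> l" for l'
    proof -
      have "emeasure (nu_part \<mu> T l) A + emeasure (nu_part \<mu> T l') A \<le> emeasure (nu_part \<mu> T l) A + 0"
        using order.trans[OF emeasure_nu_sum_ge_pair[OF A(1) l that, of \<mu> T] le[unfolded \<nu>_def]] by simp
      then have "emeasure (nu_part \<mu> T l') A = 0"
        using fin[OF A, of l] by (simp add: less_top[symmetric])
      then show ?thesis by (simp only: null_iff[OF A])
    qed
    then have "(\<lambda>t. t + l) ` A \<in> null_sets \<mu>" using * A by blast
    then have "emeasure \<nu> A = 0" using le null_iff[OF A] by simp
    then show "AE \<gamma> in \<nu>. h l \<gamma> < 1"
      using A s by (intro AE_I[of _ _ A]) (auto simp: A_def)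
  qed
qed

lemma transversal_decomposition:
  assumes "transversal L T" "add_subgroup L"
  obtains t l where "t \<in> T" "l \<in> L" "\<gamma> = t + l"
proof -
  have "\<exists>!t. t \<in> T \<inter> (\<lambda>y. \<gamma> + y) ` L"
    using assms(1) by (simp add: transversal_def cosets_def)
  then obtain y where "y \<in> L" "\<gamma> + y \<in> T" by blast
  then show thesis
    using that[of "\<gamma> + y" "- y"] assms(2) by (simp add: add_subgroup_def)
qed

lemma transversal_unique:
  assumes "transversal L T" "add_subgroup L" "s \<in> T" "t \<in> T" "s - t \<in> L"
  shows "s = t"
proof -
  have "t + (s - t) \<in> (\<lambda>y. t + y) ` L" "t + 0 \<in> (\<lambda>y. t + y) ` L"
    using assms(2,5) unfolding add_subgroup_def by blast+
  then have "s \<in> (\<lambda>y. t + y) ` L" "t \<in> (\<lambda>y. t + y) ` L" by simp_all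
  moreover have "\<exists>!u. u \<in> T \<inter> (\<lambda>y. t + y) ` L"
    using assms(1) by (simp add: transversal_def cosets_def)
  ultimately show ?thesis using assms(3,4) by blast
qed

section \<open>Characterisation of regularity\<close>

theorem theorem2p2:
  fixes H :: "'a :: {topological_ab_group_add, t2_space} set"
    and \<mu> :: "'a dual_group measure"
    and T :: "'a dual_group set"
    and h :: "'a dual_group \<Rightarrow> 'a dual_group \<Rightarrow> real"
    and \<alpha> :: real
  assumes "locally_compact_space (euclidean :: 'a topology)"
    and "add_subgroup H" and "closed H"
    and "countable (annihilator H)"
    and "regular_borel_measure \<mu>"
    and "T \<in> sets borel" and "transversal (annihilator H) T"
    and "\<And>l. l \<in> annihilator H \<Longrightarrow> h l \<in> borel_measurable borel"
    and "\<And>l \<gamma>. l \<in> annihilator H \<Longrightarrow> 0 \<le> h l \<gamma>"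
    and "\<And>l \<gamma>. l \<in> annihilator H \<Longrightarrow> \<gamma> \<notin> T \<Longrightarrow> h l \<gamma> = 0"
    and "\<And>l. l \<in> annihilator H \<Longrightarrow>
      density (nu_sum \<mu> T (annihilator H)) (\<lambda>\<gamma>. ennreal (h l \<gamma>)) = nu_part \<mu> T l"
    and "0 < \<alpha>"
  shows "H_regular \<alpha> H \<mu> \<longleftrightarrow>
    (\<forall>l\<in>annihilator H. AE \<gamma> in nu_sum \<mu> T (annihilator H). h l \<gamma> < 1)"
proof -
  let ?L = "annihilator H"
  note H = \<open>add_subgroup H\<close> and c = \<open>countable ?L\<close> and \<mu> = \<open>regular_borel_measure \<mu>\<close>
  note L = add_subgroup_annihilator[of H]
  have fin: "finite_measure \<mu>" and sets: "sets \<mu> = sets borel"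
    using \<mu> by (simp_all add: regular_borel_measure_def)
  have zero: "{f \<in> Lalpha \<alpha> \<mu>. AE \<gamma> in \<mu>. f \<gamma> = 0} \<subseteq> (\<Inter>S\<in>cosets H. Lalpha_closure \<alpha> \<mu> (trig_polys S))"
  proof safe
    fix S and f :: "'a dual_group \<Rightarrow> complex"
    assume f: "f \<in> Lalpha \<alpha> \<mu>" "AE \<gamma> in \<mu>. f \<gamma> = 0"
    then have "(\<integral>\<gamma>. norm (f \<gamma> - 0) powr \<alpha> \<partial>\<mu>) = 0"
      by (intro integral_eq_zero_AE) (auto elim: eventually_mono)
    then show "f \<in> Lalpha_closure \<alpha> \<mu> (trig_polys S)"
      unfolding Lalpha_closure_iff[OF \<open>0 < \<alpha>\<close>] using f(1)
      by (intro conjI allI impI bexI[OF _ trig_polys_zero]) simp_all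
  qed
  have "H_regular \<alpha> H \<mu> \<longleftrightarrow> (\<forall>l\<in>?L. \<forall>A\<in>sets borel. A \<subseteq> T \<longrightarrow>
      (\<forall>l'\<in>?L. l' \<noteq> l \<longrightarrow> (\<lambda>t. t + l') ` A \<in> null_sets \<mu>) \<longrightarrow> (\<lambda>t. t + l) ` A \<in> null_sets \<mu>)"
    (is "_ \<longleftrightarrow> ?no_isolated")
  proof (intro iffI ballI impI)
    fix l A
    assume reg: "H_regular \<alpha> H \<mu>" and l: "l \<in> ?L" and A: "A \<in> sets borel" "A \<subseteq> T"
      and null: "\<forall>l'\<in>?L. l' \<noteq> l \<longrightarrow> (\<lambda>t. t + l') ` A \<in> null_sets \<mu>"
    define B where "B = (\<lambda>t. t + l) ` A"
    have B: "B \<in> sets borel" unfolding B_def by (rule borel_translate[OF A(1)])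
    have shift: "(\<lambda>\<gamma>. \<gamma> + k) ` B = (\<lambda>t. t + (l + k)) ` A" for k
      by (simp add: B_def image_image add.assoc)
    have "(indicator B :: _ \<Rightarrow> complex) \<in> Lalpha_closure \<alpha> \<mu> (trig_polys S)" if S: "S \<in> cosets H" for S
    proof -
      obtain x where x: "S = (+) x ` H" using S by (auto simp: cosets_def)
      show ?thesis unfolding x
      proof (rule indicator_in_Lalpha_closure[OF \<mu> \<open>0 < \<alpha>\<close> H c B])
        fix k assume k: "k \<in> ?L" "k \<noteq> 0"
        show "(\<lambda>\<gamma>. \<gamma> + k) ` B \<in> null_sets \<mu>"
          unfolding shift using null k l L by (auto simp: add_subgroup_def)
        show "B \<inter> (\<lambda>\<gamma>. \<gamma> + k) ` B = {}"
        proof (rule ccontr)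
          assume "B \<inter> (\<lambda>\<gamma>. \<gamma> + k) ` B \<noteq> {}"
          then obtain s t where st: "s \<in> A" "t \<in> A" "s + l = (t + l) + k"
            unfolding B_def by blast
          then have "s + l = (t + k) + l" by (simp add: ac_simps)
          then have "s = t + k" by simp
          with transversal_unique[OF assms(7) L, of s t] A(2) st(1,2) k show False by auto
        qed
      qed
    qed
    then have "AE \<gamma> in \<mu>. (indicator B \<gamma> :: complex) = 0"
      using reg unfolding H_regular_def by blast
    then have "AE \<gamma> in \<mu>. \<gamma> \<notin> B" by eventually_elim (simp add: indicator_eq_0_iff)
    then show "(\<lambda>t. t + l) ` A \<in> null_sets \<mu>"
      unfolding B_def[symmetric] using B sets by (simp add: AE_iff_null_sets)
  next
    assume *: ?no_isolated
    have "AE \<gamma> in \<mu>. f \<gamma> = 0" if f: "f \<in> (\<Inter>S\<in>cosets H. Lalpha_closure \<alpha> \<mu> (trig_polys S))" for f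
    proof -
      obtain N where N: "N \<in> null_sets \<mu>"
        "\<And>\<gamma> l. l \<in> ?L \<Longrightarrow> l \<noteq> 0 \<Longrightarrow> \<gamma> \<notin> N \<Longrightarrow> \<gamma> + l \<notin> N \<Longrightarrow> f \<gamma> = 0"
        using Lalpha_closure_Inter_vanishes[OF \<mu> \<open>0 < \<alpha>\<close> c f] by blast
      have Nb: "N \<in> sets borel" using N(1) sets by auto
      \<comment> \<open>A point \<open>t + l\<close> outside \<open>N\<close> where \<open>f\<close> does not vanish has \<open>t \<in> A l\<close>.\<close>
      define A where "A l = {t \<in> T. \<forall>l'\<in>?L - {l}. t + l' \<in> N}" for l
      have A: "A l \<in> sets borel" for l
      proof -
        have shift: "(\<lambda>t. t + (- l')) ` N = {t. t + l' \<in> N}" for l'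
          unfolding translate_vimage by auto
        have "A l = T - (\<Union>l'\<in>?L - {l}. - ((\<lambda>t. t + (- l')) ` N))"
          unfolding shift by (auto simp: A_def)
        also have "\<dots> \<in> sets borel"
          by (intro sets.Diff sets.countable_UN'' countable_Diff c borel_comp borel_translate[OF Nb] assms(6))
        finally show ?thesis .
      qed
      have "(\<lambda>t. t + l') ` A l \<in> null_sets \<mu>" if "l' \<in> ?L" "l' \<noteq> l" for l l'
        by (rule null_sets_subset[OF N(1)]) (use that borel_translate[OF A] sets in \<open>auto simp: A_def\<close>)
      then have "(\<lambda>t. t + l) ` A l \<in> null_sets \<mu>" if "l \<in> ?L" for l
        using * that A by (auto simp: A_def)
      then have null: "N \<union> (\<Union>l\<in>?L. (\<lambda>t. t + l) ` A l) \<in> null_sets \<mu>"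
        using N(1) c by (intro null_sets.Un null_sets_UN')
      show ?thesis
      proof (rule AE_I'[OF null], safe)
        fix \<gamma> assume \<gamma>: "f \<gamma> \<noteq> 0" "\<gamma> \<notin> (\<Union>l\<in>?L. (\<lambda>t. t + l) ` A l)"
        obtain t l where t: "t \<in> T" "l \<in> ?L" "\<gamma> = t + l"
          by (rule transversal_decomposition[OF assms(7) L])
        then have "t \<notin> A l" using \<gamma>(2) by blast
        then obtain l' where l': "l' \<in> ?L" "l' \<noteq> l" "t + l' \<notin> N" using t(1) by (auto simp: A_def)
        have "\<gamma> + (l' + - l) = t + l'" by (simp add: t(3))
        moreover have "l' + - l \<in> ?L" using L l'(1) t(2) unfolding add_subgroup_def by blast
        moreover have "l' + - l \<noteq> 0" using l'(2) by simp
        ultimately show "\<gamma> \<in> N" using N(2)[of "l' + - l" \<gamma>] l'(3) \<gamma>(1) by metis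
      qed
    qed
    moreover have "(\<Inter>S\<in>cosets H. Lalpha_closure \<alpha> \<mu> (trig_polys S)) \<subseteq> Lalpha \<alpha> \<mu>"
      by (auto simp: cosets_def Lalpha_closure_def)
    ultimately show "H_regular \<alpha> H \<mu>" unfolding H_regular_def using zero by blast
  qed
  also have "\<dots> \<longleftrightarrow> (\<forall>l\<in>?L. AE \<gamma> in nu_sum \<mu> T ?L. h l \<gamma> < 1)"
    by (intro ball_cong refl densities_less_1_iff[OF fin sets assms(6), symmetric] assms(8-11))
  finally show ?thesis .
qed

end
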